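(* Let $d,n$ be positive integers and $\lambda\ge 2$ an integer. For every $\epsilon\in(0,1)$ there is a ReLU network architecture (a fixed topology, independent of the target function) such that for every $f\in\mathcal{F}_{d,n}$ there is an assignment of weights, all taken from the set $\{-1,\frac{1}{\lambda},\frac{2}{\lambda},\dots,\frac{\lambda-1}{\lambda}\}$, whose output $f'$ satisfies $\sup_{\mathbf{x}\in[0,1]^d}|f'(\mathbf{x})-f(\mathbf{x})|\le\epsilon$, and such that: (i) the depth is $\mathcal{O}(\log(1/\epsilon))$; (ii) the number of weights is $\mathcal{O}\left(\left(\log(1/\epsilon)+\frac{\log^2(1/\epsilon)}{\log\lambda}\right)(1/\epsilon)^{d/n}\right)$; (iii) the number of bits needed to store the network is $\mathcal{O}\left(\left(\log(\lambda)\log(1/\epsilon)+\log^2(1/\epsilon)\right)(1/\epsilon)^{d/n}\right)$. Here the implied constants depend only on $d$ and $n$.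
   Context: A ReLU network is a feedforward network with activation $\sigma(x)=\max(0,x)$, several input units, hidden units and one output unit, where each unit connects only to units in the next layer; depth is the number of layers. This is linear quantization with maximum weight precision $1/\lambda$. Each weight is stored with $\log_2(\lambda)$ bits. $\mathcal{F}_{d,n}$ denotes the set of functions $f$ in the Sobolev space $\mathscr{W}^{n,\infty}([0,1]^d)$ with $\max_{\mathbf{n}:|\mathbf{n}|\le n}\operatorname{ess\,sup}_{\mathbf{x}\in[0,1]^d}|D^{\mathbf{n}}f(\mathbf{x})|\le 1$ (weak derivatives). All logarithms are base 2. *)

theory Defs
  imports "HOL-Analysis.Analysis"
begin

definition unit_cube :: "(real^'d) set" where
  "unit_cube = cbox 0 One"

definition open_cube :: "(real^'d) set" where
  "open_cube = box 0 One"

definition partial_deriv :: "'d \<Rightarrow> (real^'d \<Rightarrow> real) \<Rightarrow> real^'d \<Rightarrow> real" where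
  "partial_deriv i g x = deriv (\<lambda>t. g (x + t *\<^sub>R axis i 1)) 0"

text \<open>Iterated classical partial derivative along a list of coordinate directions
  (a multi-index written as a list of directions, with repetitions).\<close>
fun iter_partial :: "'d list \<Rightarrow> (real^'d \<Rightarrow> real) \<Rightarrow> real^'d \<Rightarrow> real" where
  "iter_partial [] g = g"
| "iter_partial (i # is) g = partial_deriv i (iter_partial is g)"

definition smooth_fun :: "(real^'d \<Rightarrow> real) \<Rightarrow> bool" where
  "smooth_fun \<phi> \<longleftrightarrow> (\<forall>is x. iter_partial is \<phi> differentiable (at x))"

definition test_fun :: "(real^'d) set \<Rightarrow> (real^'d \<Rightarrow> real) \<Rightarrow> bool" where
  "test_fun U \<phi> \<longleftrightarrow> smooth_fun \<phi> \<and> compact (closure {x. \<phi> x \<noteq> 0})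
       \<and> closure {x. \<phi> x \<noteq> 0} \<subseteq> U"

definition weak_deriv :: "(real^'d) set \<Rightarrow> 'd list \<Rightarrow> (real^'d \<Rightarrow> real) \<Rightarrow> (real^'d \<Rightarrow> real) \<Rightarrow> bool" where
  "weak_deriv U is f g \<longleftrightarrow>
     (\<forall>\<phi>. test_fun U \<phi> \<longrightarrow>
        (LINT x:U|lborel. f x * iter_partial is \<phi> x)
          = (-1) ^ length is * (LINT x:U|lborel. g x * \<phi> x))"

text \<open>F_{d,n}: f in W^{n,infinity}([0,1]^d) with all weak derivatives of order at most n
  essentially bounded by 1; f is taken to be its continuous representative on the cube.\<close>
definition sobolev_class :: "nat \<Rightarrow> (real^'d \<Rightarrow> real) set" where
  "sobolev_class n = {f. set_borel_measurable lborel open_cube f \<and> continuous_on unit_cube f \<and>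
     (\<forall>is::'d list. length is \<le> n \<longrightarrow>
        (\<exists>g. set_borel_measurable lborel open_cube g \<and>
             (AE x in lborel. x \<in> open_cube \<longrightarrow> \<bar>g x\<bar> \<le> 1) \<and>
             weak_deriv open_cube is f g))}"

text \<open>Layers 0..net_L; layer 0 = input units (unit i reads coordinate inp i),
  layer net_L = the single (linear) output unit, layers in between are ReLU units.
  An edge (k,i,j) connects unit i of layer k to unit j of layer k+1.
  A bias (k,j) is a weight attached to unit j of layer k (a connection from a constant unit).\<close>
record 'd arch =
  net_L :: nat
  width :: "nat \<Rightarrow> nat"
  edges :: "(nat \<times> nat \<times> nat) set"
  biases :: "(nat \<times> nat) set"
  inp :: "nat \<Rightarrow> 'd"

definition valid_arch :: "'d arch \<Rightarrow> bool" where
  "valid_arch A \<longleftrightarrow> net_L A \<ge> 1 \<and> width A (net_L A) = 1 \<and>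
     bij_betw (inp A) {..<width A 0} (UNIV :: 'd set) \<and>
     edges A \<subseteq> {(k,i,j). k < net_L A \<and> i < width A k \<and> j < width A (Suc k)} \<and>
     biases A \<subseteq> {(k,j). 1 \<le> k \<and> k \<le> net_L A \<and> j < width A k}"

fun act :: "'d arch \<Rightarrow> (nat \<times> nat \<times> nat \<Rightarrow> real) \<Rightarrow> (nat \<times> nat \<Rightarrow> real)
              \<Rightarrow> real^'d \<Rightarrow> nat \<Rightarrow> nat \<Rightarrow> real" where
  "act A W b x 0 i = x $ inp A i"
| "act A W b x (Suc k) j =
     (let s = (\<Sum>i\<in>{i. i < width A k \<and> (k, i, j) \<in> edges A}. W (k, i, j) * act A W b x k i)
              + (if (Suc k, j) \<in> biases A then b (Suc k, j) else 0)
      in if Suc k = net_L A then s else max 0 s)"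

definition net_out :: "'d arch \<Rightarrow> (nat \<times> nat \<times> nat \<Rightarrow> real) \<Rightarrow> (nat \<times> nat \<Rightarrow> real)
              \<Rightarrow> real^'d \<Rightarrow> real" where
  "net_out A W b x = act A W b x (net_L A) 0"

text \<open>Depth = number of layers (input and output layer included).\<close>
definition net_depth :: "'d arch \<Rightarrow> nat" where
  "net_depth A = net_L A + 1"

definition num_weights :: "'d arch \<Rightarrow> nat" where
  "num_weights A = card (edges A) + card (biases A)"

definition qweights :: "nat \<Rightarrow> real set" where
  "qweights lam = insert (-1) {real k / real lam | k. 1 \<le> k \<and> k \<le> lam - 1}"

definition weights_in :: "nat \<Rightarrow> 'd arch \<Rightarrow> (nat \<times> nat \<times> nat \<Rightarrow> real) \<Rightarrow> (nat \<times> nat \<Rightarrow> real) \<Rightarrow> bool" where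
  "weights_in lam A W b \<longleftrightarrow> (\<forall>e\<in>edges A. W e \<in> qweights lam) \<and> (\<forall>v\<in>biases A. b v \<in> qweights lam)"

definition num_bits :: "nat \<Rightarrow> 'd arch \<Rightarrow> real" where
  "num_bits lam A = real (num_weights A) * log 2 (real lam)"

end

theory Submission
  imports Defs
begin

text \<open>The approximant is the continuous piecewise polynomial interpolant of \<open>f\<close> on a grid with
  \<open>2\<^sup>s\<close> cells per coordinate, where \<open>2\<^sup>s\<close> is of order \<open>(1/\<epsilon>) powr (1/n)\<close>. Its accuracy follows from the weak
  derivatives by mollifying \<open>f\<close> with product kernels: the mollified function has an \<open>n\<close>-th derivative
  bounded by 1 along each coordinate line, so Taylor's theorem bounds every functional that
  annihilates polynomials of degree less than \<open>n\<close>. The interpolant is a sum of terms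
  \<open>a\<^sub>q \<Prod>\<^sub>i clip (2\<^sup>s x\<^sub>i - m\<^sub>i) ^ l\<^sub>i\<close>, and each term is computed by its own column of constant
  width and depth \<open>O(log (1/\<epsilon>))\<close>; only the digits of the coefficients \<open>a\<^sub>q\<close>, stored in base \<open>\<lambda>\<close>,
  depend on \<open>f\<close>. Multiplications use the sawtooth expansion of the square, scaled up by \<open>4\<^sup>m\<close> so that
  integer weights suffice, and scaled down by a constant in base \<open>\<lambda>\<close> at the end.\<close>

section \<open>A smooth bump function\<close>

text \<open>The set of weights contains neither 0 nor 1 and no negative number except -1, and one
  topology has to serve every \<open>f\<close>; this shapes the construction. A digit 0 cannot be a
  missing edge, and a coefficient can neither choose its sign nor exceed 1. Hence every term has
  columns for either sign, at most one of which receives a nonzero coefficient, and each column is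
  repeated so often that the coefficient divided by the number of repetitions is below 1. All
  arithmetic errs downwards: partial products then stay in [0, 1], where the squaring recursion is
  valid and errors do not grow. The number of digits is chosen as if \<lambda> were 2, which makes
  depth and size uniform in \<lambda>. The estimate in several variables interpolates one coordinate
  at a time, each time with a functional on a coordinate line.\<close>

definition flat :: "real poly \<Rightarrow> real \<Rightarrow> real" where
  "flat p x = (if x \<le> 0 then 0 else poly p (1 / x) * exp (- (1 / x)))"

lemma power_poly_exp_tendsto_0:
  "((\<lambda>y::real. y ^ k * poly p y * exp (- y)) \<longlongrightarrow> 0) at_top"
proof (induction p arbitrary: k)
  case (pCons a p)
  have "((\<lambda>y::real. a * (y ^ k / exp y) + y ^ Suc k * poly p y * exp (- y)) \<longlongrightarrow> a * 0 + 0) at_top"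
    by (intro tendsto_intros tendsto_power_div_exp_0 pCons.IH)
  then show ?case
    by (simp add: algebra_simps exp_minus divide_inverse)
qed simp

lemma flat_tendsto_0: "(flat p \<longlongrightarrow> 0) (at 0)"
proof -
  have "(flat p \<longlongrightarrow> 0) (at_left 0)"
    by (rule Lim_transform_eventually[of "\<lambda>_. 0"]) (auto simp: flat_def eventually_at_left_field intro: exI[of _ "-1"])
  moreover have "((\<lambda>x. poly p (inverse x) * exp (- inverse x)) \<longlongrightarrow> 0) (at_right (0::real))"
    using filterlim_compose[OF power_poly_exp_tendsto_0[of 0 p] filterlim_inverse_at_top_right] by simp
  then have "(flat p \<longlongrightarrow> 0) (at_right 0)"
    by (rule Lim_transform_eventually)
       (auto simp: flat_def eventually_at_right_field field_simps intro!: exI[of _ 1])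
  ultimately show ?thesis
    using filterlim_at_split by blast
qed

text \<open>With \<open>y = 1 / x\<close> the derivative of \<open>p(y) exp(-y)\<close> in
  \<open>x\<close> is \<open>y^2 (p(y) - p'(y)) exp(-y)\<close>, so the family is closed under
  differentiation. At 0 the difference quotient is \<open>flat\<close> of \<open>p\<close> times the
  variable, which tends to 0.\<close>

lemma flat_has_derivative:
  "(flat p has_real_derivative flat ([:0, 0, 1:] * (p - pderiv p)) x) (at x)"
proof (cases x "0::real" rule: linorder_cases)
  case less
  have "((\<lambda>_. 0) has_real_derivative 0) (at x)" by simp
  then have "(flat p has_real_derivative 0) (at x)"
    by (rule has_field_derivative_transform_within_open[of _ _ _ "{..<0}"])
       (use less in \<open>auto simp: flat_def\<close>)
  then show ?thesis using less by (simp add: flat_def)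
next
  case equal
  have "(flat p has_real_derivative 0) (at 0)"
    unfolding DERIV_def
  proof (rule Lim_transform_eventually[OF flat_tendsto_0[of "[:0, 1:] * p"]])
    show "\<forall>\<^sub>F h in at 0. flat ([:0, 1:] * p) h = (flat p (0 + h) - flat p 0) / h"
      by (rule eventuallyI) (auto simp: flat_def)
  qed
  then show ?thesis using equal by (simp add: flat_def)
next
  case greater
  have "((\<lambda>x. poly p (1 / x) * exp (- (1 / x))) has_real_derivative
          flat ([:0, 0, 1:] * (p - pderiv p)) x) (at x)"
    using greater
    by (auto intro!: derivative_eq_intros DERIV_chain2[OF poly_DERIV] simp: flat_def field_simps power2_eq_square)
  then show ?thesis
    by (rule has_field_derivative_transform_within_open[of _ _ _ "{0<..}"])
       (use greater in \<open>auto simp: flat_def\<close>)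
qed

text \<open>The product rule turns a product of two \<open>flat\<close> factors into a sum of two
  such products. Closing under sums gives a family that is stable under differentiation and vanishes
  outside (-1, 1).\<close>

inductive_set bumps :: "(real \<Rightarrow> real) set" where
  prod: "(\<lambda>x. flat p (1 + x) * flat q (1 - x)) \<in> bumps"
| add: "f \<in> bumps \<Longrightarrow> g \<in> bumps \<Longrightarrow> (\<lambda>x. f x + g x) \<in> bumps"

lemma bumps_derivative: "f \<in> bumps \<Longrightarrow> \<exists>f'\<in>bumps. \<forall>x. (f has_real_derivative f' x) (at x)"
proof (induction rule: bumps.induct)
  case (prod p q)
  let ?D = "\<lambda>p. [:0, 0, 1:] * (p - pderiv p)"
  have neg: "flat (- r) x = - flat r x" for r x by (simp add: flat_def)
  have "((\<lambda>x. flat p (1 + x) * flat q (1 - x)) has_real_derivative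
      flat (?D p) (1 + x) * flat q (1 - x) + flat p (1 + x) * flat (- ?D q) (1 - x)) (at x)" for x
    unfolding neg
    by (rule derivative_eq_intros DERIV_chain2[OF flat_has_derivative] refl | simp)+
  then show ?case
    by (intro bexI[OF _ bumps.add[OF bumps.prod bumps.prod]]) blast
next
  case (add f g)
  then obtain f' g' where "f' \<in> bumps" "g' \<in> bumps"
    "\<And>x. (f has_real_derivative f' x) (at x)" "\<And>x. (g has_real_derivative g' x) (at x)" by blast
  then show ?case
    by (intro bexI[of _ "\<lambda>x. f' x + g' x"]) (auto intro!: derivative_intros bumps.add)
qed

lemma bumps_support: "f \<in> bumps \<Longrightarrow> 1 \<le> \<bar>x\<bar> \<Longrightarrow> f x = 0"
  by (induction rule: bumps.induct) (auto simp: flat_def)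

text \<open>\<open>D 0\<close> is \<open>exp(-1/(1+x)) exp(-1/(1-x))\<close> on (-1, 1) and
  \<open>D k\<close> is its \<open>k\<close>-th derivative. With the whole sequence at hand,
  differentiating merely raises an index.\<close>

lemma smooth_bump_exists:
  obtains D :: "nat \<Rightarrow> real \<Rightarrow> real" where
    "\<And>k x. (D k has_real_derivative D (Suc k) x) (at x)"
    "\<And>k x. 1 \<le> \<bar>x\<bar> \<Longrightarrow> D k x = 0"
    "\<And>x. 0 \<le> D 0 x" "\<And>x. \<bar>x\<bar> < 1 \<Longrightarrow> 0 < D 0 x"
proof -
  define dv where "dv f = (SOME f'. f' \<in> bumps \<and> (\<forall>x. (f has_real_derivative f' x) (at x)))" for f
  have dv: "dv f \<in> bumps \<and> (\<forall>x. (f has_real_derivative dv f x) (at x))" if "f \<in> bumps" for f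
    unfolding dv_def using bumps_derivative[OF that, unfolded Bex_def] by (rule someI_ex)
  define D where "D k = (dv ^^ k) (\<lambda>x. flat 1 (1 + x) * flat 1 (1 - x))" for k
  have mem: "D k \<in> bumps" for k
    by (induction k) (simp_all add: D_def bumps.prod dv)
  show ?thesis
  proof
    show "(D k has_real_derivative D (Suc k) x) (at x)" for k x
      using dv[OF mem[of k]] by (simp add: D_def)
    show "D k x = 0" if "1 \<le> \<bar>x\<bar>" for k x
      using bumps_support[OF mem that] .
  qed (auto simp: D_def flat_def)
qed

section \<open>Product kernels as test functions\<close>

lemma One_vec_nth: "(One :: real^'d) $ j = 1"
  by (simp flip: Cart_1)

locale bump =
  fixes D :: "nat \<Rightarrow> real \<Rightarrow> real"
  assumes D_deriv: "\<And>k x. (D k has_real_derivative D (Suc k) x) (at x)"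
    and D_supp: "\<And>k x. 1 \<le> \<bar>x\<bar> \<Longrightarrow> D k x = 0"
    and D_nonneg: "\<And>x. 0 \<le> D 0 x"
    and D_pos: "\<And>x. \<bar>x\<bar> < 1 \<Longrightarrow> 0 < D 0 x"
begin

text \<open>\<open>c j\<close> counts the derivatives taken of the \<open>j\<close>-th factor. Since
  only \<open>p - y\<close> enters, differentiating in \<open>p\<close> produces
  \<open>1 / \<delta>\<close> and differentiating in \<open>y\<close> produces
  \<open>- 1 / \<delta>\<close>.\<close>

definition ker :: "real \<Rightarrow> ('d::finite \<Rightarrow> nat) \<Rightarrow> real^'d \<Rightarrow> real^'d \<Rightarrow> real" where
  "ker \<delta> c p y = (\<Prod>j\<in>UNIV. D (c j) ((p $ j - y $ j) / \<delta>))"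

lemma D_differentiable: "D k differentiable (at x)"
  using D_deriv real_differentiable_def by blast

lemma D_continuous: "continuous_on S (D k)"
  by (meson D_deriv DERIV_isCont continuous_at_imp_continuous_on)

lemma ker_continuous:
  assumes "continuous_on S g" "continuous_on S h" "\<delta> \<noteq> 0"
  shows "continuous_on S (\<lambda>z. ker \<delta> c (g z) (h z))"
  unfolding ker_def
  by (intro continuous_intros continuous_on_compose2[OF D_continuous[of UNIV]] assms) (use assms in auto)

lemma ker_differentiable:
  assumes "\<delta> \<noteq> 0"
  shows "(\<lambda>y. ker \<delta> c p y) differentiable (at y)"
proof -
  have "(\<lambda>y. D (c j) ((p $ j - y $ j) / \<delta>)) differentiable (at y)" for j
  proof -
    have "((\<lambda>y. (p $ j - y $ j) / \<delta>) has_derivative (\<lambda>h. (0 - h $ j) / \<delta>)) (at y)"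
      unfolding divide_inverse
      by (intro has_derivative_mult_left has_derivative_diff has_derivative_const
            bounded_linear.has_derivative[OF bounded_linear_vec_nth] has_derivative_ident)
    then show ?thesis
      by (intro differentiable_compose[OF D_differentiable]) (auto simp: differentiable_def)
  qed
  then have "\<exists>F'. \<forall>j. ((\<lambda>y. D (c j) ((p $ j - y $ j) / \<delta>)) has_derivative F' j) (at y)"
    unfolding differentiable_def by (rule choice[OF allI])
  then obtain F' where "\<And>j. ((\<lambda>y. D (c j) ((p $ j - y $ j) / \<delta>)) has_derivative F' j) (at y)"
    by blast
  from has_derivative_prod[where I = UNIV and f = "\<lambda>j y. D (c j) ((p $ j - y $ j) / \<delta>)", OF this] show ?thesis
    unfolding ker_def differentiable_def by blast
qed

lemma ker_split:
  "ker \<delta> c p y = D (c i) ((p $ i - y $ i) / \<delta>) * (\<Prod>j\<in>UNIV - {i}. D (c j) ((p $ j - y $ j) / \<delta>))"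
  unfolding ker_def by (subst prod.remove[of _ i]) auto

text \<open>The factor \<open>a\<close> is carried along because every differentiation contributes a
  factor of its own; this makes the formula iterable.\<close>

lemma partial_deriv_ker:
  assumes "\<delta> \<noteq> 0"
  shows "partial_deriv i (\<lambda>y. a * ker \<delta> c p y) y = a * (- 1 / \<delta>) * ker \<delta> (c(i := Suc (c i))) p y"
proof -
  have "((\<lambda>t. a * (D (c i) ((p $ i - (y $ i + t)) / \<delta>) * (\<Prod>j\<in>UNIV - {i}. D (c j) ((p $ j - y $ j) / \<delta>))))
      has_real_derivative a * (D (Suc (c i)) ((p $ i - (y $ i + 0)) / \<delta>) * (- 1 / \<delta>) *
         (\<Prod>j\<in>UNIV - {i}. D (c j) ((p $ j - y $ j) / \<delta>)))) (at 0)"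
    using assms
    by (intro DERIV_cmult DERIV_cmult_right DERIV_chain2[OF D_deriv]) (auto intro!: derivative_eq_intros)
  moreover have "a * ker \<delta> c p (y + t *\<^sub>R axis i 1) =
     a * (D (c i) ((p $ i - (y $ i + t)) / \<delta>) * (\<Prod>j\<in>UNIV - {i}. D (c j) ((p $ j - y $ j) / \<delta>)))" for t
    unfolding ker_split[where i = i] by (auto simp: axis_def intro!: prod.cong)
  moreover have "ker \<delta> (c(i := Suc (c i))) p y =
      D (Suc (c i)) ((p $ i - y $ i) / \<delta>) * (\<Prod>j\<in>UNIV - {i}. D (c j) ((p $ j - y $ j) / \<delta>))"
    unfolding ker_split[where i = i] by auto
  ultimately show ?thesis
    unfolding partial_deriv_def by (simp only: DERIV_imp_deriv) simp
qed

lemma iter_partial_ker: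
  assumes "\<delta> \<noteq> 0"
  shows "iter_partial is (ker \<delta> (\<lambda>_. 0) p) =
         (\<lambda>y. (- 1 / \<delta>) ^ length is * ker \<delta> (\<lambda>j. count_list is j) p y)"
proof (induction "is")
  case (Cons i "is")
  have *: "(\<lambda>j. count_list (i # is) j) = (count_list is)(i := Suc (count_list is i))"
    by auto
  show ?case
    unfolding iter_partial.simps Cons.IH * by (rule ext) (simp only: partial_deriv_ker[OF assms], simp add: mult_ac fun_upd_def)
qed simp

lemma smooth_ker:
  assumes "\<delta> \<noteq> 0"
  shows "smooth_fun (ker \<delta> (\<lambda>_. 0) p)"
  unfolding smooth_fun_def iter_partial_ker[OF assms]
  by (intro allI differentiable_mult ker_differentiable assms) simp

lemma ker_support:
  assumes "ker \<delta> c p y \<noteq> 0" "\<delta> > 0"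
  shows "\<bar>p $ j - y $ j\<bar> < \<delta>"
proof (rule ccontr)
  assume "\<not> ?thesis"
  then have "D (c j) ((p $ j - y $ j) / \<delta>) = 0"
    using assms(2) by (intro D_supp) (simp add: field_simps)
  then show False using assms(1) ker_def by (metis (no_types, lifting) UNIV_I finite prod_zero_iff)
qed

lemma test_fun_ker:
  assumes "\<delta> > 0" "\<And>j. \<delta> < p $ j" "\<And>j. p $ j + \<delta> < 1"
  shows "test_fun open_cube (ker \<delta> (\<lambda>_. 0) p)"
proof -
  let ?K = "cbox (\<chi> j. p $ j - \<delta>) (\<chi> j. p $ j + \<delta>)"
  have "{y. ker \<delta> (\<lambda>_. 0) p y \<noteq> 0} \<subseteq> ?K"
  proof
    fix y assume "y \<in> {y. ker \<delta> (\<lambda>_. 0) p y \<noteq> 0}"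
    then have "\<bar>p $ j - y $ j\<bar> < \<delta>" for j using ker_support[OF _ assms(1)] by blast
    then show "y \<in> ?K" by (auto simp: mem_box_cart abs_less_iff less_imp_le intro!: less_imp_le) (smt (verit))+
  qed
  then have "closure {y. ker \<delta> (\<lambda>_. 0) p y \<noteq> 0} \<subseteq> ?K"
    by (intro closure_minimal closed_cbox)
  moreover have "?K \<subseteq> open_cube"
  proof
    fix y assume "y \<in> ?K"
    then have "p $ j - \<delta> \<le> y $ j" "y $ j \<le> p $ j + \<delta>" for j by (auto simp: mem_box_cart)
    then have "0 < y $ j" "y $ j < 1" for j
      using assms(2)[of j] assms(3)[of j] by (smt (verit))+
    then show "y \<in> open_cube" unfolding open_cube_def by (simp only: mem_box_cart One_vec_nth zero_index simp_thms)
  qed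
  moreover from calculation(1) have "compact (closure {y. ker \<delta> (\<lambda>_. 0) p y \<noteq> 0})"
    by (metis bounded_cbox bounded_subset closed_closure compact_eq_bounded_closed)
  ultimately show ?thesis
    unfolding test_fun_def using smooth_ker[of \<delta> p] assms(1) by auto
qed

end

section \<open>Mollification and the weak derivative\<close>

definition vupd :: "real^'d \<Rightarrow> 'd \<Rightarrow> real \<Rightarrow> real^'d" where
  "vupd p i t = (\<chi> j. if j = i then t else p $ j)"

lemma vupd_nth [simp]: "vupd p i t $ j = (if j = i then t else p $ j)"
  by (simp add: vupd_def)

lemma mem_unit_cube: "x \<in> unit_cube \<longleftrightarrow> (\<forall>j. 0 \<le> x $ j \<and> x $ j \<le> 1)"
  unfolding unit_cube_def by (simp only: mem_box_cart One_vec_nth zero_index)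

lemma mem_open_cube: "x \<in> open_cube \<longleftrightarrow> (\<forall>j. 0 < x $ j \<and> x $ j < 1)"
  unfolding open_cube_def by (simp only: mem_box_cart One_vec_nth zero_index)

lemma open_cube_subset: "open_cube \<subseteq> unit_cube"
  by (auto simp: mem_open_cube mem_unit_cube less_imp_le)

lemma continuous_on_vupd: "continuous_on S (\<lambda>t. vupd p i t)"
proof -
  have "continuous_on S (\<lambda>t. if j = i then t else p $ j)" for j
    by (cases "j = i") auto
  then show ?thesis unfolding vupd_def by (intro continuous_on_vec_lambda)
qed

text \<open>A bridge between two integrals: weak derivatives are stated with the Lebesgue integral
  over the open cube, while differentiation under the integral sign uses the gauge integral over the
  closed one.\<close>

lemma set_integrable_open_cube:
  fixes h :: "real^'d \<Rightarrow> real"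
  assumes "continuous_on unit_cube h"
  shows "set_integrable lborel open_cube h"
    and "(LINT x:open_cube|lborel. h x) = integral unit_cube h"
proof -
  have "set_integrable lborel unit_cube h"
    using borel_integrable_compact[of unit_cube h] assms
    by (simp add: set_integrable_def unit_cube_def indicator_scaleR_eq_if)
  then show *: "set_integrable lborel open_cube h"
    by (rule set_integrable_subset) (simp_all add: open_cube_subset, simp add: open_cube_def)
  show "(LINT x:open_cube|lborel. h x) = integral unit_cube h"
    using set_borel_integral_eq_integral(2)[OF *] integral_open_interval[of 0 One h]
    by (simp add: unit_cube_def open_cube_def)
qed

context bump
begin

text \<open>A convolution that is not divided by the mass of the kernel; the estimates compare it
  with the mass times a value of \<open>f\<close>.\<close>

definition moll :: "(real^'d \<Rightarrow> real) \<Rightarrow> real \<Rightarrow> ('d::finite \<Rightarrow> nat) \<Rightarrow> real^'d \<Rightarrow> real" where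
  "moll f \<delta> c p = integral unit_cube (\<lambda>y. f y * ker \<delta> c p y)"

lemma ker_vupd_derivative:
  assumes "\<delta> \<noteq> 0"
  shows "((\<lambda>t. ker \<delta> c (vupd p i t) y) has_real_derivative
            1 / \<delta> * ker \<delta> (c(i := Suc (c i))) (vupd p i t) y) (at t)"
proof -
  have *: "(\<Prod>j\<in>UNIV - {i}. D ((c(i := r)) j) ((vupd p i t $ j - y $ j) / \<delta>)) =
      (\<Prod>j\<in>UNIV - {i}. D (c j) ((p $ j - y $ j) / \<delta>))" for t r
    by (rule prod.cong) auto
  have "((\<lambda>t. D (c i) ((t - y $ i) / \<delta>) * (\<Prod>j\<in>UNIV - {i}. D (c j) ((p $ j - y $ j) / \<delta>)))
     has_real_derivative D (Suc (c i)) ((t - y $ i) / \<delta>) * (1 / \<delta>)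
       * (\<Prod>j\<in>UNIV - {i}. D (c j) ((p $ j - y $ j) / \<delta>))) (at t)"
    by (intro DERIV_cmult_right DERIV_chain2[OF D_deriv]) (auto intro!: derivative_eq_intros simp: assms)
  then show ?thesis
    unfolding ker_split[where i = i] *[of "Suc (c i)"] using *[of "c i"] by (simp add: mult_ac)
qed

lemma moll_derivative:
  assumes "continuous_on unit_cube f" "\<delta> \<noteq> 0"
  shows "((\<lambda>t. moll f \<delta> c (vupd p i t)) has_real_derivative
            1 / \<delta> * moll f \<delta> (c(i := Suc (c i))) (vupd p i t)) (at t)"
proof -
  let ?c = "c(i := Suc (c i))"
  have "((\<lambda>t. integral (cbox 0 One) (\<lambda>y. f y * ker \<delta> c (vupd p i t) y)) has_real_derivative
     integral (cbox 0 One) (\<lambda>y. f y * (1 / \<delta> * ker \<delta> ?c (vupd p i t) y))) (at t within UNIV)"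
  proof (rule leibniz_rule_field_derivative)
    show "(\<lambda>y. f y * ker \<delta> c (vupd p i t) y) integrable_on cbox 0 One" for t
      using assms unfolding unit_cube_def[symmetric]
      by (subst unit_cube_def, intro integrable_continuous) (auto simp flip: unit_cube_def intro!: continuous_intros ker_continuous)
    show "continuous_on (UNIV \<times> cbox 0 One) (\<lambda>(t, y). f y * (1 / \<delta> * ker \<delta> ?c (vupd p i t) y))"
      using assms unfolding split_beta
      by (intro continuous_intros ker_continuous continuous_on_compose2[OF assms(1)]
            continuous_on_compose2[OF continuous_on_vupd[of UNIV]])
         (auto simp: unit_cube_def)
    show "((\<lambda>t. f y * ker \<delta> c (vupd p i t) y) has_real_derivative
        f y * (1 / \<delta> * ker \<delta> ?c (vupd p i t) y)) (at t within UNIV)" for t y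
      by (intro DERIV_cmult ker_vupd_derivative assms)
  qed simp_all
  moreover have "integral (cbox 0 One) (\<lambda>y. f y * (1 / \<delta> * ker \<delta> ?c (vupd p i t) y)) =
      1 / \<delta> * moll f \<delta> ?c (vupd p i t)"
    unfolding moll_def unit_cube_def integral_mult_right[symmetric] by (simp add: mult_ac)
  ultimately show ?thesis by (simp add: moll_def unit_cube_def)
qed

text \<open>Around \<open>p\<close> the kernel is a test function, so its \<open>k\<close>
  derivatives in direction \<open>i\<close> can be moved to \<open>f\<close>, where they become a
  function bounded by 1 almost everywhere. The sign of the weak derivative cancels the one from
  differentiating in \<open>y\<close>. What remains is the integral of the nonnegative
  kernel.\<close>

lemma moll_weak_derivative_bound:
  assumes f: "f \<in> sobolev_class n" and "k \<le> n"
    and \<delta>: "\<delta> > 0" "\<And>j. \<delta> < p $ j" "\<And>j. p $ j + \<delta> < 1"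
  shows "\<bar>(1 / \<delta>) ^ k * moll f \<delta> (\<lambda>j. if j = i then k else 0) p\<bar> \<le> moll (\<lambda>_. 1) \<delta> (\<lambda>_. 0) p"
proof -
  let ?is = "replicate k i" and ?\<phi> = "ker \<delta> (\<lambda>_. 0) p"
  let ?\<psi> = "ker \<delta> (\<lambda>j. if j = i then k else 0) p"
  from f \<open>k \<le> n\<close> have cont: "continuous_on unit_cube f"
    and "\<exists>g. set_borel_measurable lborel open_cube g \<and>
             (AE x in lborel. x \<in> open_cube \<longrightarrow> \<bar>g x\<bar> \<le> 1) \<and> weak_deriv open_cube ?is f g"
    unfolding sobolev_class_def by auto
  then obtain g where g: "set_borel_measurable lborel open_cube g"
    "AE x in lborel. x \<in> open_cube \<longrightarrow> \<bar>g x\<bar> \<le> 1" "weak_deriv open_cube ?is f g" by blast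
  have cker: "continuous_on S (ker \<delta> c p)" for S c
    using \<delta> by (intro ker_continuous continuous_intros) auto
  have cl: "(\<lambda>j. count_list ?is j) = (\<lambda>j. if j = i then k else 0)"
  proof -
    have "count_list ?is j = (if j = i then k else 0)" for j
      by (induction k) auto
    then show ?thesis by blast
  qed
  have "(LINT x:open_cube|lborel. f x * ((- 1 / \<delta>) ^ k * ?\<psi> x)) =
      (-1) ^ k * (LINT x:open_cube|lborel. g x * ?\<phi> x)"
  proof -
    have "iter_partial ?is ?\<phi> = (\<lambda>x. (- 1 / \<delta>) ^ k * ?\<psi> x)"
      using iter_partial_ker[of \<delta> ?is p] \<delta>(1) unfolding cl by simp
    then show ?thesis
      using g(3)[unfolded weak_deriv_def, rule_format, OF test_fun_ker[OF \<delta>]]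
      by (simp only: length_replicate)
  qed
  moreover have "(LINT x:open_cube|lborel. f x * ((- 1 / \<delta>) ^ k * ?\<psi> x)) =
      integral unit_cube (\<lambda>x. f x * ((- 1 / \<delta>) ^ k * ?\<psi> x))"
    by (intro set_integrable_open_cube continuous_intros cont cker)
  moreover have "integral unit_cube (\<lambda>x. f x * ((- 1 / \<delta>) ^ k * ?\<psi> x)) = (- 1 / \<delta>) ^ k * moll f \<delta> (\<lambda>j. if j = i then k else 0) p"
    unfolding moll_def integral_mult_right[symmetric] by (simp add: mult_ac)
  moreover have "(- 1 / \<delta>) ^ k = (-1) ^ k * (1 / \<delta>) ^ k"
    by (simp flip: power_mult_distrib)
  ultimately have "\<bar>(1 / \<delta>) ^ k * moll f \<delta> (\<lambda>j. if j = i then k else 0) p\<bar> = \<bar>LINT x:open_cube|lborel. g x * ?\<phi> x\<bar>"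
    by (simp add: mult.assoc)
  also have "\<dots> \<le> (LINT x:open_cube|lborel. ?\<phi> x)"
  proof -
    have \<phi>0: "0 \<le> ?\<phi> x" for x
      unfolding ker_def by (intro prod_nonneg) (simp add: D_nonneg)
    have int\<phi>: "integrable lborel (\<lambda>x. indicator open_cube x *\<^sub>R ?\<phi> x)"
      using set_integrable_open_cube(1)[OF cker, unfolded set_integrable_def] .
    have bd: "AE x in lborel. norm (indicator open_cube x *\<^sub>R (g x * ?\<phi> x)) \<le> indicator open_cube x *\<^sub>R ?\<phi> x"
      using g(2) by eventually_elim (auto simp: indicator_def abs_mult \<phi>0 intro!: mult_left_le_one_le)
    have "(\<lambda>x. (indicator open_cube x *\<^sub>R g x) * ?\<phi> x) \<in> borel_measurable lborel"
      using g(1) unfolding set_borel_measurable_def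
      by (intro borel_measurable_times) (auto intro!: borel_measurable_continuous_onI cker)
    then have meas: "(\<lambda>x. indicator open_cube x *\<^sub>R (g x * ?\<phi> x)) \<in> borel_measurable lborel"
      by (simp add: mult_ac)
    have intg: "integrable lborel (\<lambda>x. indicator open_cube x *\<^sub>R (g x * ?\<phi> x))"
      using bd by (intro Bochner_Integration.integrable_bound[OF int\<phi> meas]) (auto elim!: eventually_mono)
    have "\<bar>LINT x:open_cube|lborel. g x * ?\<phi> x\<bar> \<le> (LINT x|lborel. norm (indicator open_cube x *\<^sub>R (g x * ?\<phi> x)))"
      unfolding set_lebesgue_integral_def real_norm_def[symmetric] by (rule integral_norm_bound)
    also have "\<dots> \<le> (LINT x|lborel. indicator open_cube x *\<^sub>R ?\<phi> x)"
      by (rule integral_mono_AE[OF integrable_norm[OF intg] int\<phi> bd])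
    finally show ?thesis by (simp add: set_lebesgue_integral_def)
  qed
  also have "\<dots> = moll (\<lambda>_. 1) \<delta> (\<lambda>_. 0) p"
    by (subst set_integrable_open_cube(2)[OF cker]) (simp add: moll_def)
  finally show ?thesis .
qed

definition mass :: "'d::finite itself \<Rightarrow> real \<Rightarrow> real" where
  "mass _ \<delta> = (LINT y|lborel. ker \<delta> (\<lambda>_::'d. 0) 0 y)"

text \<open>The support lies inside the cube, so the integral is one over the whole space and
  invariant under translation. Thus the same mass serves all points of a line.\<close>

lemma moll_one:
  fixes p :: "real^'d::finite"
  assumes \<delta>: "\<delta> > 0" "\<And>j. \<delta> < p $ j" "\<And>j. p $ j + \<delta> < 1"
  shows "moll (\<lambda>_. 1) \<delta> (\<lambda>_. 0) p = mass TYPE('d) \<delta>"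
proof -
  let ?\<phi> = "ker \<delta> (\<lambda>_. 0) p"
  have cker: "continuous_on S ?\<phi>" for S
    using \<delta> by (intro ker_continuous continuous_intros) auto
  have "?\<phi> y = 0" if "y \<notin> open_cube" for y
  proof (rule ccontr)
    assume "?\<phi> y \<noteq> 0"
    then have "\<bar>p $ j - y $ j\<bar> < \<delta>" for j using ker_support \<delta>(1) by blast
    with \<delta> have "0 < y $ j" "y $ j < 1" for j by (smt (verit))+
    with that show False by (simp add: mem_open_cube)
  qed
  then have "(\<lambda>y. indicator open_cube y *\<^sub>R ?\<phi> y) = ?\<phi>"
    by (intro ext) (simp add: indicator_def, blast)
  then have "moll (\<lambda>_. 1) \<delta> (\<lambda>_. 0) p = (LINT y|lborel. ?\<phi> y)"
    using set_integrable_open_cube(2)[OF cker] unfolding moll_def set_lebesgue_integral_def by simp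
  also have "\<dots> = (LINT y|distr lborel borel ((+) p). ?\<phi> y)"
    by (simp add: lborel_distr_plus)
  also have "\<dots> = (LINT y|lborel. ?\<phi> (p + y))"
    by (intro integral_distr) (auto intro!: borel_measurable_continuous_onI cker)
  also have "\<dots> = mass TYPE('d) \<delta>"
    by (simp add: ker_def mass_def)
  finally show ?thesis .
qed

lemma mass_pos:
  assumes "0 < \<delta>" "\<delta> < 1 / 2"
  shows "0 < mass TYPE('d::finite) \<delta>"
proof -
  let ?p = "(\<chi> j. 1 / 2) :: real^'d"
  let ?\<phi> = "ker \<delta> (\<lambda>_. 0) ?p"
  have cker: "continuous_on S ?\<phi>" for S
    using assms by (intro ker_continuous continuous_intros) auto
  have nonneg: "0 \<le> ?\<phi> y" for y
    unfolding ker_def by (intro prod_nonneg) (simp add: D_nonneg)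
  have mass: "mass TYPE('d) \<delta> = integral (cbox 0 One) ?\<phi>"
    using moll_one[of \<delta> ?p] assms by (simp add: moll_def unit_cube_def)
  have int: "?\<phi> integrable_on cbox 0 One"
    by (intro integrable_continuous cker)
  have "?p \<in> open_cube" by (simp add: mem_open_cube)
  then have ne: "box 0 One \<noteq> ({} :: (real^'d) set)" "?p \<in> cbox 0 One"
    using open_cube_subset by (auto simp: open_cube_def unit_cube_def)
  have "integral (cbox 0 One) ?\<phi> \<noteq> 0"
  proof
    assume "integral (cbox 0 One) ?\<phi> = 0"
    then have "(?\<phi> has_integral 0) (cbox 0 One)"
      using integrable_integral[OF int] by simp
    from has_integral_0_cbox_imp_0[OF cker nonneg this ne] have "?\<phi> ?p = 0" .
    then show False using D_pos[of 0] by (simp add: ker_def)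
  qed
  moreover have "0 \<le> integral (cbox 0 One) ?\<phi>"
    using int nonneg by (rule integral_nonneg)
  ultimately show ?thesis using mass by simp
qed

lemma moll_approx:
  fixes f :: "real^'d::finite \<Rightarrow> real" and p :: "real^'d"
  assumes cont: "continuous_on unit_cube f"
    and \<delta>: "\<delta> > 0" "\<And>j. \<delta> < p $ j" "\<And>j. p $ j + \<delta> < 1"
    and near: "\<And>y :: real^'d. y \<in> unit_cube \<Longrightarrow> (\<And>j. \<bar>p $ j - y $ j\<bar> < \<delta>) \<Longrightarrow> \<bar>f y - f p\<bar> \<le> \<eta>"
  shows "\<bar>moll f \<delta> (\<lambda>_. 0) p - f p * mass TYPE('d) \<delta>\<bar> \<le> \<eta> * mass TYPE('d) \<delta>"
proof -
  let ?\<phi> = "ker \<delta> (\<lambda>_. 0) p"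
  have cker: "continuous_on S ?\<phi>" for S
    using \<delta> by (intro ker_continuous continuous_intros) auto
  have nonneg: "0 \<le> ?\<phi> y" for y
    unfolding ker_def by (intro prod_nonneg) (simp add: D_nonneg)
  have int: "h integrable_on unit_cube" if "continuous_on unit_cube h" for h :: "real^'d \<Rightarrow> real"
    using that unfolding unit_cube_def by (rule integrable_continuous)
  have mass: "integral unit_cube (\<lambda>y. a * ?\<phi> y) = a * mass TYPE('d) \<delta>" for a
    using moll_one[OF \<delta>] by (simp add: moll_def)
  have "moll f \<delta> (\<lambda>_. 0) p - f p * mass TYPE('d) \<delta> = integral unit_cube (\<lambda>y. f y * ?\<phi> y - f p * ?\<phi> y)"
    unfolding moll_def mass[symmetric]
    by (intro Henstock_Kurzweil_Integration.integral_diff[symmetric] int continuous_intros cont cker)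
  also have "norm \<dots> \<le> integral unit_cube (\<lambda>y. \<eta> * ?\<phi> y)"
  proof (intro integral_norm_bound_integral int continuous_intros cont cker)
    fix y :: "real^'d" assume y: "y \<in> unit_cube"
    show "norm (f y * ?\<phi> y - f p * ?\<phi> y) \<le> \<eta> * ?\<phi> y"
    proof (cases "?\<phi> y = 0")
      case False
      then have "\<bar>f y - f p\<bar> \<le> \<eta>" using near[OF y] ker_support \<delta>(1) by blast
      then show ?thesis
        using nonneg[of y] by (simp flip: left_diff_distrib add: abs_mult mult_right_mono)
    qed simp
  qed
  finally show ?thesis by (simp only: mass real_norm_def)
qed

end

section \<open>Functionals annihilating polynomials\<close>

context bump
begin

text \<open>A Bramble-Hilbert argument on a coordinate line. \<open>F m\<close> is the
  \<open>m\<close>-th derivative of the mollified \<open>f\<close> along the line, and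
  \<open>F n\<close> is bounded by the mass \<open>M\<close>. The functional kills the Taylor
  polynomial \<open>T\<close> at \<open>a\<close>, so only its remainder, at most
  \<open>M * (b - a) ^ n\<close>, and the mollification error \<open>\<eta> * M\<close> contribute;
  the slack \<open>e\<close> absorbs the latter.\<close>

lemma annihilator_bound_open:
  fixes f :: "real^'d::finite \<Rightarrow> real" and w t :: "'k \<Rightarrow> real"
  assumes f: "f \<in> sobolev_class n" and n: "n \<ge> 1" and p: "p \<in> open_cube"
    and ab: "0 < a" "a < b" "b < 1" and K: "finite K"
    and t: "\<And>k. k \<in> K \<Longrightarrow> 0 \<le> t k \<and> t k \<le> 1"
    and ann: "\<And>m. m < n \<Longrightarrow> (\<Sum>k\<in>K. w k * t k ^ m) = 0"
  shows "\<bar>\<Sum>k\<in>K. w k * f (vupd p i (a + (b - a) * t k))\<bar> \<le> (\<Sum>k\<in>K. \<bar>w k\<bar>) * (b - a) ^ n"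
proof (rule field_le_epsilon)
  fix e :: real assume e: "0 < e"
  define W where "W = (\<Sum>k\<in>K. \<bar>w k\<bar>)"
  have W0: "0 \<le> W" unfolding W_def by (simp add: sum_nonneg)
  define \<eta> where "\<eta> = e / (W + 1)"
  have \<eta>: "0 < \<eta>" "W * \<eta> \<le> e" using e W0 by (simp_all add: \<eta>_def field_simps)
  let ?\<tau> = "\<lambda>k. a + (b - a) * t k"
  let ?P = "\<lambda>k. vupd p i (?\<tau> k)"
  have \<tau>: "a \<le> ?\<tau> k" "?\<tau> k \<le> b" if "k \<in> K" for k
    using t[OF that] ab mult_left_le[of "t k" "b - a"] mult_nonneg_nonneg[of "b - a" "t k"] by - linarith+
  have cont: "continuous_on unit_cube f" using f by (simp add: sobolev_class_def)
  have Pin: "?P k \<in> open_cube" if "k \<in> K" for k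
    using \<tau>[OF that] p ab by (auto simp: mem_open_cube intro: less_le_trans le_less_trans)
  have "\<forall>k\<in>K. \<exists>d>0. \<forall>y\<in>unit_cube. dist y (?P k) < d \<longrightarrow> dist (f y) (f (?P k)) < \<eta>"
    using cont Pin open_cube_subset \<eta>(1) unfolding continuous_on_iff by blast
  then obtain dd where dd: "\<And>k. k \<in> K \<Longrightarrow> dd k > 0"
    "\<And>k y. k \<in> K \<Longrightarrow> y \<in> unit_cube \<Longrightarrow> dist y (?P k) < dd k \<Longrightarrow> dist (f y) (f (?P k)) < \<eta>"
    by metis
  \<comment> \<open>\<open>S\<close> collects the positive numbers that \<open>\<delta>\<close> must
    stay below: the distances of the segment and of the coordinates of \<open>p\<close> from the
    boundary, 1/2 for the positivity of the mass, and the continuity radii at the nodes. The radii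
    are divided by the dimension because the distance is estimated by the sum of the coordinate
    distances.\<close>
  define S where "S = {a, 1 - b, 1 / 2} \<union> range (\<lambda>j. p $ j) \<union> range (\<lambda>j. 1 - p $ j) \<union> (\<lambda>k. dd k / real CARD('d)) ` K"
  have S: "finite S" "S \<noteq> {}" using K by (auto simp: S_def)
  have Spos: "0 < s" if "s \<in> S" for s
    using that ab p dd(1) by (auto simp: S_def mem_open_cube)
  define \<delta> where "\<delta> = Min S / 2"
  have "0 < Min S" using S Spos by simp
  then have \<delta>0: "0 < \<delta>" and \<delta>S: "\<And>s. s \<in> S \<Longrightarrow> \<delta> < s"
    using Min_le[OF S(1)] by (force simp: \<delta>_def)+
  have \<delta>: "\<delta> < a" "\<delta> < 1 - b" "\<delta> < 1 / 2" "\<And>j. \<delta> < p $ j" "\<And>j. \<delta> < 1 - p $ j"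
    "\<And>k. k \<in> K \<Longrightarrow> \<delta> < dd k / real CARD('d)"
    using \<delta>S[of "1 / 2"] by (auto intro!: \<delta>S simp: S_def)
  have marg: "\<And>j. \<delta> < vupd p i s $ j" "\<And>j. vupd p i s $ j + \<delta> < 1" if "a \<le> s" "s \<le> b" for s
    using \<delta> that by (auto simp: algebra_simps)
  define M where "M = mass TYPE('d) \<delta>"
  have M: "0 < M" unfolding M_def using mass_pos \<delta>0 \<delta>(3) .
  define c where "c m = (\<lambda>j. if j = i then m else 0 :: nat)" for m
  define F where "F m s = (1 / \<delta>) ^ m * moll f \<delta> (c m) (vupd p i s)" for m s
  have c0: "c 0 = (\<lambda>_. 0)" by (simp add: c_def)
  have F_deriv: "(F m has_real_derivative F (Suc m) s) (at s)" for m s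
  proof -
    have "(c m)(i := Suc (c m i)) = c (Suc m)" by (auto simp: c_def)
    then show ?thesis
      using DERIV_cmult[OF moll_derivative[OF cont, of \<delta> "c m" p i s], of "(1 / \<delta>) ^ m"] \<delta>0
      unfolding F_def[abs_def] by (simp add: mult_ac)
  qed
  have F_bound: "\<bar>F n s\<bar> \<le> M" if "a \<le> s" "s \<le> b" for s
    using moll_weak_derivative_bound[OF f order_refl \<delta>0 marg[OF that]] moll_one[OF \<delta>0 marg[OF that]]
    by (simp add: F_def c_def M_def)
  have F_approx: "\<bar>F 0 (?\<tau> k) - f (?P k) * M\<bar> \<le> \<eta> * M" if k: "k \<in> K" for k
  proof -
    have "\<bar>f y - f (?P k)\<bar> \<le> \<eta>" if y: "y \<in> unit_cube" "\<And>j. \<bar>?P k $ j - y $ j\<bar> < \<delta>" for y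
    proof -
      have "dist y (?P k) \<le> (\<Sum>j\<in>UNIV. \<bar>(y - ?P k) $ j\<bar>)"
        unfolding dist_norm by (rule norm_le_l1_cart)
      also have "\<dots> \<le> (\<Sum>j\<in>(UNIV :: 'd set). \<delta>)"
        using y(2) by (intro sum_mono) (simp add: abs_minus_commute less_imp_le del: vupd_nth)
      also have "\<dots> < dd k" using \<delta>(6)[OF k] by (simp add: field_simps)
      finally show ?thesis using dd(2)[OF k y(1)] by (simp add: dist_real_def)
    qed
    from moll_approx[OF cont \<delta>0 marg[OF \<tau>[OF k]] this] show ?thesis
      by (simp add: F_def c0 M_def)
  qed
  define T where "T s = (\<Sum>m<n. F m a / fact m * (s - a) ^ m)" for s
  have taylor: "\<bar>F 0 s - T s\<bar> \<le> M * (b - a) ^ n" if s: "a \<le> s" "s \<le> b" for s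
  proof (cases "s = a")
    case True
    have "T a = F 0 a"
      using n unfolding T_def by (subst sum.remove[of _ 0]) (auto intro!: sum.neutral)
    then show ?thesis using True M ab by simp
  next
    case False
    from Taylor[of n F "F 0" a b a s] n s F_deriv ab False
    obtain r where r: "a < r" "r < s" "F 0 s = T s + F n r / fact n * (s - a) ^ n"
      unfolding T_def by (auto split: if_splits)
    have "\<bar>F 0 s - T s\<bar> = \<bar>F n r\<bar> / fact n * (s - a) ^ n"
      using r s by (simp add: abs_mult power_abs)
    also have "\<dots> \<le> M * (b - a) ^ n"
    proof (intro mult_mono power_mono)
      have "\<bar>F n r\<bar> / fact n \<le> \<bar>F n r\<bar> / 1" by (intro divide_left_mono) auto
      then show "\<bar>F n r\<bar> / fact n \<le> M" using F_bound[of r] r s by simp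
    qed (use s M in auto)
    finally show ?thesis .
  qed
  have "(\<Sum>k\<in>K. w k * T (?\<tau> k)) = (\<Sum>m<n. F m a / fact m * (b - a) ^ m * (\<Sum>k\<in>K. w k * t k ^ m))"
    unfolding T_def sum_distrib_left by (subst sum.swap) (simp add: power_mult_distrib mult_ac)
  also have "\<dots> = 0" by (intro sum.neutral) (simp add: ann)
  finally have T0: "(\<Sum>k\<in>K. w k * T (?\<tau> k)) = 0" .
  \<comment> \<open>The sum over \<open>T\<close> vanishes; subtracting it splits each term into a
    mollification error and a Taylor remainder.\<close>
  have eq: "(\<Sum>k\<in>K. w k * f (?P k)) * M =
    (\<Sum>k\<in>K. w k * (f (?P k) * M - F 0 (?\<tau> k)) + w k * (F 0 (?\<tau> k) - T (?\<tau> k)))"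
    unfolding sum.distrib right_diff_distrib sum_subtractf T0 by (simp add: sum_distrib_right mult.assoc)
  have "\<bar>(\<Sum>k\<in>K. w k * f (?P k)) * M\<bar> \<le> (\<Sum>k\<in>K. \<bar>w k\<bar> * (\<eta> * M + M * (b - a) ^ n))"
    unfolding eq
  proof (intro order_trans[OF sum_abs] sum_mono)
    fix k assume k: "k \<in> K"
    have "\<bar>w k * (f (?P k) * M - F 0 (?\<tau> k)) + w k * (F 0 (?\<tau> k) - T (?\<tau> k))\<bar>
       \<le> \<bar>w k\<bar> * (\<bar>f (?P k) * M - F 0 (?\<tau> k)\<bar> + \<bar>F 0 (?\<tau> k) - T (?\<tau> k)\<bar>)"
      unfolding distrib_left abs_mult[symmetric] by (rule abs_triangle_ineq)
    also have "\<dots> \<le> \<bar>w k\<bar> * (\<eta> * M + M * (b - a) ^ n)"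
      using F_approx[OF k] taylor[OF \<tau>[OF k]] by (intro mult_left_mono add_mono) (auto simp: abs_minus_commute)
    finally show "\<bar>w k * (f (?P k) * M - F 0 (?\<tau> k)) + w k * (F 0 (?\<tau> k) - T (?\<tau> k))\<bar>
       \<le> \<bar>w k\<bar> * (\<eta> * M + M * (b - a) ^ n)" .
  qed
  also have "\<dots> = (W * (b - a) ^ n + W * \<eta>) * M"
    unfolding sum_distrib_right[symmetric] W_def[symmetric] by (simp add: algebra_simps)
  finally have "\<bar>\<Sum>k\<in>K. w k * f (?P k)\<bar> \<le> W * (b - a) ^ n + W * \<eta>"
    using M by (simp add: abs_mult)
  then show "\<bar>\<Sum>k\<in>K. w k * f (?P k)\<bar> \<le> (\<Sum>k\<in>K. \<bar>w k\<bar>) * (b - a) ^ n + e"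
    using \<eta>(2) by (simp add: W_def)
qed

text \<open>The case of no derivative: averages of \<open>f\<close> against the kernel are at most
  the mass, and continuity turns averages into values.\<close>

lemma sobolev_class_bounded_open:
  fixes f :: "real^'d::finite \<Rightarrow> real"
  assumes f: "f \<in> sobolev_class n" and p: "p \<in> open_cube"
  shows "\<bar>f p\<bar> \<le> 1"
proof (rule field_le_epsilon)
  fix e :: real assume e: "0 < e"
  have cont: "continuous_on unit_cube f" using f by (simp add: sobolev_class_def)
  obtain d where d: "d > 0" "\<And>y. y \<in> unit_cube \<Longrightarrow> dist y p < d \<Longrightarrow> dist (f y) (f p) < e"
    using cont p open_cube_subset e unfolding continuous_on_iff by blast
  define S where "S = {1 / 2, d / real CARD('d)} \<union> range (\<lambda>j. p $ j) \<union> range (\<lambda>j. 1 - p $ j)"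
  have S: "finite S" "S \<noteq> {}" by (auto simp: S_def)
  have Spos: "0 < s" if "s \<in> S" for s
    using that p d(1) by (auto simp: S_def mem_open_cube)
  define \<delta> where "\<delta> = Min S / 2"
  have "0 < Min S" using S Spos by simp
  then have \<delta>0: "0 < \<delta>" and \<delta>S: "\<And>s. s \<in> S \<Longrightarrow> \<delta> < s"
    using Min_le[OF S(1)] by (force simp: \<delta>_def)+
  have \<delta>: "\<delta> < 1 / 2" "\<delta> < d / real CARD('d)" "\<And>j. \<delta> < p $ j" "\<And>j. \<delta> < 1 - p $ j"
    using \<delta>S[of "1 / 2"] by (auto intro!: \<delta>S simp: S_def)
  then have marg: "\<And>j. p $ j + \<delta> < 1" by (simp add: algebra_simps)
  define M where "M = mass TYPE('d) \<delta>"
  have M: "0 < M" unfolding M_def using mass_pos \<delta>0 \<delta>(1) .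
  have "\<bar>f y - f p\<bar> \<le> e" if y: "y \<in> unit_cube" "\<And>j. \<bar>p $ j - y $ j\<bar> < \<delta>" for y
  proof -
    have "dist y p \<le> (\<Sum>j\<in>UNIV. \<bar>(y - p) $ j\<bar>)"
      unfolding dist_norm by (rule norm_le_l1_cart)
    also have "\<dots> \<le> (\<Sum>j\<in>(UNIV :: 'd set). \<delta>)"
      using y(2) by (intro sum_mono) (simp add: abs_minus_commute less_imp_le)
    also have "\<dots> < d" using \<delta>(2) by (simp add: field_simps)
    finally show ?thesis using d(2)[OF y(1)] by (simp add: dist_real_def)
  qed
  from moll_approx[OF cont \<delta>0 \<delta>(3) marg this]
  have "\<bar>moll f \<delta> (\<lambda>_. 0) p - f p * M\<bar> \<le> e * M" by (simp add: M_def)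
  moreover have "\<bar>moll f \<delta> (\<lambda>_. 0) p\<bar> \<le> M"
    using moll_weak_derivative_bound[OF f _ \<delta>0 \<delta>(3) marg, of 0] moll_one[OF \<delta>0 \<delta>(3) marg]
    by (simp add: M_def)
  ultimately have "\<bar>f p * M\<bar> \<le> (1 + e) * M" by (simp add: algebra_simps)
  then show "\<bar>f p\<bar> \<le> 1 + e" using M by (simp add: abs_mult)
qed

end

section \<open>From the open to the closed cube\<close>

definition shrink :: "real \<Rightarrow> real^'d \<Rightarrow> real^'d" where
  "shrink e x = (\<chi> j. (1 - e) * x $ j + e / 2)"

lemma shrink_open_cube:
  assumes "x \<in> unit_cube" "0 < e" "e < 1"
  shows "shrink e x \<in> open_cube"
proof -
  have "0 < (1 - e) * x $ j + e / 2" "(1 - e) * x $ j + e / 2 < 1" for j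
  proof -
    have "0 \<le> (1 - e) * x $ j" "(1 - e) * x $ j \<le> 1 - e"
      using assms unfolding mem_unit_cube by (intro mult_nonneg_nonneg mult_left_le; simp)+
    with assms(2,3) show "0 < (1 - e) * x $ j + e / 2" "(1 - e) * x $ j + e / 2 < 1" by - linarith+
  qed
  then show ?thesis by (simp add: mem_open_cube shrink_def)
qed

lemma shrink_limit:
  assumes cont: "continuous_on unit_cube f" and x: "x \<in> unit_cube"
  shows "(\<lambda>m. f (shrink (1 / real (m + 2)) x)) \<longlonglongrightarrow> f x"
proof (rule continuous_on_tendsto_compose[OF cont _ x])
  have lim: "(\<lambda>m. 1 / real (m + 2)) \<longlonglongrightarrow> 0"
    by (rule LIMSEQ_ignore_initial_segment[OF lim_1_over_n])
  have "(\<lambda>m. (1 - 1 / real (m + 2)) * x $ j + 1 / real (m + 2) / 2) \<longlonglongrightarrow> (1 - 0) * x $ j + 0 / 2" for j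
    by (intro tendsto_intros lim) simp
  then show "(\<lambda>m. shrink (1 / real (m + 2)) x) \<longlonglongrightarrow> x"
    by (intro vec_tendstoI) (simp add: shrink_def)
  show "\<forall>\<^sub>F m in sequentially. shrink (1 / real (m + 2)) x \<in> unit_cube"
    using shrink_open_cube[OF x] open_cube_subset by (intro always_eventually allI subsetD[OF open_cube_subset]) simp
qed

text \<open>Contracting the cube towards its centre maps coordinate lines to coordinate lines and
  keeps the relative positions \<open>t k\<close> on the segment, whose length becomes
  \<open>(1 - e) * (b - a)\<close>. So the bound for interior points applies, and continuity up to
  the boundary lets \<open>e\<close> tend to 0.\<close>

lemma annihilator_bound:
  fixes f :: "real^'d::finite \<Rightarrow> real" and w t :: "'k \<Rightarrow> real"
  assumes f: "f \<in> sobolev_class n" and n: "n \<ge> 1" and p: "p \<in> unit_cube"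
    and ab: "0 \<le> a" "a < b" "b \<le> 1" and K: "finite K"
    and t: "\<And>k. k \<in> K \<Longrightarrow> 0 \<le> t k \<and> t k \<le> 1"
    and ann: "\<And>m. m < n \<Longrightarrow> (\<Sum>k\<in>K. w k * t k ^ m) = 0"
  shows "\<bar>\<Sum>k\<in>K. w k * f (vupd p i (a + (b - a) * t k))\<bar> \<le> (\<Sum>k\<in>K. \<bar>w k\<bar>) * (b - a) ^ n"
proof -
  obtain D where "bump D" using smooth_bump_exists unfolding bump_def by metis
  then interpret bump D .
  let ?P = "\<lambda>k. vupd p i (a + (b - a) * t k)" and ?e = "\<lambda>m. 1 / real (m + 2)"
  have cont: "continuous_on unit_cube f" using f by (simp add: sobolev_class_def)
  have P: "?P k \<in> unit_cube" if "k \<in> K" for k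
  proof -
    have "0 \<le> (b - a) * t k" "(b - a) * t k \<le> b - a"
      using t[OF that] ab by (auto intro: mult_left_le)
    then have "0 \<le> a + (b - a) * t k" "a + (b - a) * t k \<le> 1" using ab by - linarith+
    then show ?thesis using p by (auto simp: mem_unit_cube)
  qed
  have "\<bar>\<Sum>k\<in>K. w k * f (shrink (?e m) (?P k))\<bar> \<le> (\<Sum>k\<in>K. \<bar>w k\<bar>) * (b - a) ^ n" for m
  proof -
    define e where "e = ?e m"
    have e: "0 < e" "e < 1" by (simp_all add: e_def)
    define a' b' where "a' = (1 - e) * a + e / 2" and "b' = (1 - e) * b + e / 2"
    have ba: "b' - a' = (1 - e) * (b - a)" by (simp add: a'_def b'_def algebra_simps)
    have eq: "shrink e (?P k) = vupd (shrink e p) i (a' + (b' - a') * t k)" for k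
      unfolding ba by (simp add: vec_eq_iff shrink_def a'_def algebra_simps)
    have "(1 - e) * b \<le> 1 - e" "0 \<le> (1 - e) * a" "0 < b' - a'"
      using e ab by (auto simp: ba intro!: mult_left_le)
    then have ab': "0 < a'" "a' < b'" "b' < 1" using e unfolding a'_def b'_def by - linarith+
    have "\<bar>\<Sum>k\<in>K. w k * f (shrink e (?P k))\<bar> \<le> (\<Sum>k\<in>K. \<bar>w k\<bar>) * (b' - a') ^ n"
      unfolding eq by (rule annihilator_bound_open[OF f n shrink_open_cube[OF p e] ab' K t ann])
    also have "\<dots> \<le> (\<Sum>k\<in>K. \<bar>w k\<bar>) * (b - a) ^ n"
      using ab' ab e unfolding ba
      by (intro mult_left_mono power_mono) (auto simp: sum_nonneg intro!: mult_left_le_one_le)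
    finally show ?thesis by (simp add: e_def)
  qed
  moreover have "(\<lambda>m. \<bar>\<Sum>k\<in>K. w k * f (shrink (?e m) (?P k))\<bar>) \<longlonglongrightarrow> \<bar>\<Sum>k\<in>K. w k * f (?P k)\<bar>"
    by (intro tendsto_intros shrink_limit cont P)
  ultimately show ?thesis
    by (intro LIMSEQ_le_const2) auto
qed

lemma sobolev_class_bounded:
  fixes f :: "real^'d::finite \<Rightarrow> real"
  assumes f: "f \<in> sobolev_class n" and p: "p \<in> unit_cube"
  shows "\<bar>f p\<bar> \<le> 1"
proof -
  obtain D where "bump D" using smooth_bump_exists unfolding bump_def by metis
  then interpret bump D .
  have "continuous_on unit_cube f" using f by (simp add: sobolev_class_def)
  from tendsto_rabs[OF shrink_limit[OF this p]] show ?thesis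
    by (rule LIMSEQ_le_const2)
       (intro exI[of _ 0] allI impI sobolev_class_bounded_open[OF f] shrink_open_cube[OF p], simp_all)
qed

section \<open>Piecewise Lagrange interpolation\<close>

text \<open>The Lagrange basis for equidistant nodes in [0, 1]. Both end points are nodes, so
  neighbouring pieces agree where they meet.\<close>

definition lag :: "nat \<Rightarrow> nat \<Rightarrow> real poly" where
  "lag n k = (\<Prod>j\<in>{..n} - {k}. smult (1 / (real k / n - real j / n)) [:- (real j / n), 1:])"

lemma degree_lag: "k \<le> n \<Longrightarrow> degree (lag n k) \<le> n"
proof -
  assume k: "k \<le> n"
  have "degree (lag n k) \<le> (\<Sum>j\<in>{..n} - {k}. 1)"
    unfolding lag_def
  proof (rule order_trans[OF degree_prod_sum_le])
    show "sum (degree \<circ> (\<lambda>j. smult (1 / (real k / n - real j / n)) [:- (real j / n), 1:])) ({..n} - {k}) \<le> (\<Sum>j\<in>{..n} - {k}. 1)"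
      unfolding comp_def by (intro sum_mono order_trans[OF degree_smult_le]) simp
  qed simp
  then show ?thesis using k by simp
qed

lemma poly_lag:
  assumes "n \<ge> 1" "j \<le> n" "k \<le> n"
  shows "poly (lag n k) (real j / n) = (if j = k then 1 else 0)"
proof (cases "j = k")
  case True
  have "real k / n - real i / n \<noteq> 0" if "i \<in> {..n} - {k}" for i
    using that assms by auto
  moreover have "poly (smult (1 / (a - b)) [:- b, 1:]) a = 1" if "a - b \<noteq> 0" for a b :: real
    using that by (simp add: diff_divide_distrib[symmetric])
  ultimately have "poly (lag n k) (real k / n) = 1" unfolding lag_def poly_prod
    by (intro prod.neutral) blast
  with True show ?thesis by simp
next
  case False
  then show ?thesis unfolding lag_def poly_prod
    using assms by (auto intro!: prod_zero bexI[of _ j])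
qed

lemma lag_reproduces:
  assumes n: "n \<ge> 1" and p: "degree p \<le> n"
  shows "(\<Sum>k\<le>n. poly p (real k / n) * poly (lag n k) t) = poly p t"
proof -
  let ?q = "\<Sum>k\<le>n. smult (poly p (real k / n)) (lag n k)"
  have inj: "inj_on (\<lambda>j. real j / n) {..n}" using n by (auto simp: inj_on_def)
  have "?q = p"
  proof (rule poly_eqI_degree[of "(\<lambda>j. real j / n) ` {..n}"])
    fix x assume "x \<in> (\<lambda>j. real j / n) ` {..n}"
    then obtain j where j: "j \<le> n" "x = real j / n" by auto
    show "poly ?q x = poly p x"
      unfolding j(2) poly_sum poly_smult using j(1) n
      by (simp add: poly_lag if_distrib cong: if_cong)
  next
    have "degree ?q \<le> n"
      by (intro degree_sum_le order_trans[OF degree_smult_le] degree_lag) auto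
    then show "degree ?q < card ((\<lambda>j. real j / n) ` {..n})"
      using card_image[OF inj] by simp
    show "degree p < card ((\<lambda>j. real j / n) ` {..n})"
      using card_image[OF inj] p by simp
  qed
  then have "poly ?q t = poly p t" by simp
  then show ?thesis by (simp add: poly_sum)
qed

text \<open>Bounds the Lebesgue constant plus 1, where the 1 is the weight of the point itself in
  the error functional. It also bounds every single coefficient of the basis polynomials.\<close>

definition leb_const :: "nat \<Rightarrow> real" where
  "leb_const n = 1 + (\<Sum>k\<le>n. \<Sum>l\<le>n. \<bar>coeff (lag n k) l\<bar>)"

lemma poly_lag_altdef:
  assumes "k \<le> n"
  shows "poly (lag n k) t = (\<Sum>l\<le>n. coeff (lag n k) l * t ^ l)"
  using degree_lag[OF assms] unfolding poly_altdef
  by (intro sum.mono_neutral_left) (auto simp: coeff_eq_0)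

lemma sum_abs_lag_le:
  assumes "0 \<le> t" "t \<le> 1"
  shows "(\<Sum>k\<le>n. \<bar>poly (lag n k) t\<bar>) + 1 \<le> leb_const n"
proof -
  have "\<bar>poly (lag n k) t\<bar> \<le> (\<Sum>l\<le>n. \<bar>coeff (lag n k) l\<bar>)" if "k \<le> n" for k
    unfolding poly_lag_altdef[OF that]
    using assms by (intro order_trans[OF sum_abs] sum_mono) (auto simp: abs_mult power_le_one mult_left_le)
  then have "(\<Sum>k\<le>n. \<bar>poly (lag n k) t\<bar>) \<le> (\<Sum>k\<le>n. \<Sum>l\<le>n. \<bar>coeff (lag n k) l\<bar>)"
    by (intro sum_mono) simp
  then show ?thesis by (simp add: leb_const_def)
qed

lemma leb_const_ge_1: "1 \<le> leb_const n"
  by (simp add: leb_const_def sum_nonneg)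

definition clip :: "real \<Rightarrow> real" where
  "clip z = min 1 (max 0 z)"

lemma clip_bounds: "0 \<le> clip z" "clip z \<le> 1"
  by (simp_all add: clip_def)

definition cells :: "nat \<Rightarrow> nat \<Rightarrow> (nat \<times> nat \<times> nat) set" where
  "cells n N = {..<N} \<times> {..n} \<times> {..n}"

text \<open>The constant terms of all cells but the first vanish, so that the clipped cell polynomials
  telescope to the interpolant.\<close>
definition icoef :: "nat \<Rightarrow> nat \<times> nat \<times> nat \<Rightarrow> real" where
  "icoef n = (\<lambda>(m, k, l). if l = 0 \<and> 0 < m then 0 else coeff (lag n k) l)"

definition ibasis :: "nat \<Rightarrow> nat \<times> nat \<times> nat \<Rightarrow> real \<Rightarrow> real" where
  "ibasis N = (\<lambda>(m, k, l) x. clip (real N * x - real m) ^ l)"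

definition inode :: "nat \<Rightarrow> nat \<Rightarrow> nat \<times> nat \<times> nat \<Rightarrow> real" where
  "inode n N = (\<lambda>(m, k, l). (real m + real k / n) / N)"

lemma inode_bounds:
  assumes "q \<in> cells n N"
  shows "0 \<le> inode n N q \<and> inode n N q \<le> 1"
proof -
  obtain m k l where q: "q = (m, k, l)" "m < N" "k \<le> n"
    using assms by (auto simp: cells_def)
  have "real k / n \<le> 1" using q(3) by (simp add: divide_le_eq)
  moreover have "real m + 1 \<le> real N" using q(2) by linarith
  ultimately have "real m + real k / n \<le> real N" by linarith
  then show ?thesis using q by (auto simp: inode_def divide_le_eq)
qed

text \<open>Left of the cell of \<open>x\<close> the clipped variable is 1, and a piece contributes
  the difference of its end values (the first piece just its right end value); right of it the
  variable is 0 and nothing is contributed. The finished cells telescope to the left end value of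
  the current one. Cell and local coordinate depend on \<open>x\<close> alone.\<close>

lemma interpolant_on_cell:
  assumes n: "n \<ge> 1" and N: "N \<ge> 1" and x: "0 \<le> x" "x \<le> 1"
  obtains m t where "m < N" "0 \<le> t" "t \<le> 1" "x = (real m + t) / N"
    "\<forall>g. (\<Sum>q\<in>cells n N. icoef n q * ibasis N q x * g (inode n N q)) =
        (\<Sum>k\<le>n. poly (lag n k) t * g ((real m + real k / n) / N))"
proof -
  \<comment> \<open>At \<open>x = 1\<close> the floor would be \<open>N\<close>, which is not a
    cell; the last cell with local coordinate 1 takes its place.\<close>
  define m0 where "m0 = (if x = 1 then N - 1 else nat \<lfloor>real N * x\<rfloor>)"
  define t where "t = real N * x - real m0"
  have "m0 < N \<and> 0 \<le> t \<and> t \<le> 1"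
  proof (cases "x = 1")
    case False
    then have "real N * x < real N" using x N by simp
    moreover have "0 \<le> real N * x" using x by simp
    ultimately show ?thesis using False by (simp add: m0_def t_def nat_less_iff floor_less_iff) linarith
  qed (use N in \<open>auto simp: m0_def t_def\<close>)
  then have m0: "m0 < N" and t: "0 \<le> t" "t \<le> 1" by auto
  have clip: "clip (real N * x - real m) = (if m < m0 then 1 else if m = m0 then t else 0)" for m
  proof -
    have *: "real N * x - real m = (real m0 - real m) + t" by (simp add: t_def)
    show ?thesis
    proof (cases m m0 rule: linorder_cases)
      case less
      then have "real m + 1 \<le> real m0" by linarith
      then show ?thesis using less t unfolding * clip_def by simp
    next
      case greater
      then have "real m0 + 1 \<le> real m" by linarith
      then show ?thesis using greater t unfolding * clip_def by simp
    next
      case equal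
      then show ?thesis using t unfolding * clip_def by simp
    qed
  qed
  have "(\<Sum>q\<in>cells n N. icoef n q * ibasis N q x * g (inode n N q)) =
        (\<Sum>k\<le>n. poly (lag n k) t * g ((real m0 + real k / n) / N))" for g :: "real \<Rightarrow> real"
  proof -
    define P where "P m c = (\<Sum>k\<le>n. poly (lag n k) c * g ((real m + real k / n) / N))" for m :: nat and c
    define G where "G m = g (real m / N)" for m :: nat
    have lag0: "poly (lag n k) 0 = (if k = 0 then 1 else 0)" if "k \<le> n" for k
      using poly_lag[OF n _ that, of 0] by auto
    have lag1: "poly (lag n k) 1 = (if k = n then 1 else 0)" if "k \<le> n" for k
      using poly_lag[OF n _ that, of n] n by auto
    have P0: "P m 0 = G m" for m
      by (simp add: P_def G_def lag0 if_distrib[of "\<lambda>u. u * _"] cong: if_cong)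
    have P1: "P m 1 = G (Suc m)" for m
      using n by (simp add: P_def G_def lag1 if_distrib[of "\<lambda>u. u * _"] add.commute cong: if_cong)
    have cell: "(\<Sum>k\<le>n. \<Sum>l\<le>n. icoef n (m, k, l) * c ^ l * g ((real m + real k / n) / N)) =
        P m c - (if 0 < m then G m else 0)" for m c
    proof -
      have "(\<Sum>l\<le>n. icoef n (m, k, l) * c ^ l) =
          poly (lag n k) c - (if 0 < m \<and> k = 0 then 1 else 0)" if k: "k \<le> n" for k
      proof -
        have "(\<Sum>l\<le>n. icoef n (m, k, l) * c ^ l) =
            (\<Sum>l\<le>n. coeff (lag n k) l * c ^ l - (if l = 0 then (if 0 < m then coeff (lag n k) 0 else 0) else 0))"
          by (intro sum.cong) (auto simp: icoef_def)
        also have "\<dots> = poly (lag n k) c - (if 0 < m then coeff (lag n k) 0 else 0)"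
          by (simp add: sum_subtractf poly_lag_altdef[OF k])
        finally show ?thesis using lag0[OF k] by (cases "k = 0") (simp_all add: poly_0_coeff_0)
      qed
      then have "(\<Sum>k\<le>n. (\<Sum>l\<le>n. icoef n (m, k, l) * c ^ l) * g ((real m + real k / n) / N)) =
          (\<Sum>k\<le>n. poly (lag n k) c * g ((real m + real k / n) / N)
             - (if k = 0 then (if 0 < m then g (real m / N) else 0) else 0))"
        by (intro sum.cong) (auto simp: left_diff_distrib)
      also have "\<dots> = P m c - (if 0 < m then G m else 0)"
        by (simp add: sum_subtractf P_def G_def)
      finally show ?thesis by (simp add: sum_distrib_right)
    qed
    have tele: "(\<Sum>m<j. G (Suc m) - (if 0 < m then G m else 0)) = (if 0 < j then G j else 0)" for j
      by (induction j) auto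
    have "(\<Sum>q\<in>cells n N. icoef n q * ibasis N q x * g (inode n N q)) =
      (\<Sum>m<N. \<Sum>k\<le>n. \<Sum>l\<le>n. icoef n (m, k, l) * clip (real N * x - real m) ^ l * g ((real m + real k / n) / N))"
      by (simp add: cells_def sum.cartesian_product split_beta ibasis_def inode_def)
    also have "\<dots> = (\<Sum>m<N. P m (clip (real N * x - real m)) - (if 0 < m then G m else 0))"
      by (simp add: cell)
    also have "\<dots> = (\<Sum>m\<in>{..<Suc m0}. P m (clip (real N * x - real m)) - (if 0 < m then G m else 0))"
      by (rule sum.mono_neutral_right) (use m0 in \<open>auto simp: clip P0\<close>)
    also have "\<dots> = (\<Sum>m<m0. G (Suc m) - (if 0 < m then G m else 0)) + (P m0 t - (if 0 < m0 then G m0 else 0))"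
      by (simp add: clip P1)
    also have "\<dots> = P m0 t" by (simp add: tele)
    finally show ?thesis by (simp add: P_def)
  qed
  moreover have "x = (real m0 + t) / N" using N by (simp add: t_def)
  ultimately show ?thesis using that m0 t by blast
qed

section \<open>Interpolation in several variables, one coordinate after the other\<close>

definition tensor :: "nat \<Rightarrow> nat \<Rightarrow> 'd::finite set \<Rightarrow> (real^'d \<Rightarrow> real) \<Rightarrow> real^'d \<Rightarrow> real" where
  "tensor n N S f x = (\<Sum>q\<in>PiE S (\<lambda>_. cells n N).
     (\<Prod>i\<in>S. icoef n (q i) * ibasis N (q i) (x $ i)) * f (\<chi> j. if j \<in> S then inode n N (q j) else x $ j))"

lemma tensor_insert:
  assumes "i \<notin> S"
  shows "tensor n N (insert i S) f x =
    (\<Sum>r\<in>cells n N. icoef n r * ibasis N r (x $ i) * tensor n N S f (vupd x i (inode n N r)))"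
proof -
  have eq: "PiE (insert i S) (\<lambda>_. cells n N) = (\<lambda>(y, g). g(i := y)) ` (cells n N \<times> PiE S (\<lambda>_. cells n N))"
    by (rule PiE_insert_eq)
  have inj: "inj_on (\<lambda>(y, g). g(i := y)) (cells n N \<times> PiE S (\<lambda>_. cells n N))"
    using inj_combinator[OF assms, of "\<lambda>_. cells n N"] by simp
  have vec: "(\<chi> j. if j \<in> insert i S then inode n N ((q(i := r)) j) else x $ j) =
      (\<chi> j. if j \<in> S then inode n N (q j) else vupd x i (inode n N r) $ j)" for q r
    using assms by (auto simp: vec_eq_iff)
  have prod: "(\<Prod>j\<in>insert i S. icoef n ((q(i := r)) j) * ibasis N ((q(i := r)) j) (x $ j)) =
     (icoef n r * ibasis N r (x $ i)) * (\<Prod>j\<in>S. icoef n (q j) * ibasis N (q j) (vupd x i (inode n N r) $ j))" for q r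
  proof -
    have "(\<Prod>j\<in>S. icoef n ((q(i := r)) j) * ibasis N ((q(i := r)) j) (x $ j)) =
       (\<Prod>j\<in>S. icoef n (q j) * ibasis N (q j) (vupd x i (inode n N r) $ j))"
      using assms by (intro prod.cong) auto
    then show ?thesis using assms by (subst prod.insert) auto
  qed
  show ?thesis
    unfolding tensor_def eq sum.reindex[OF inj]
    by (subst sum_distrib_left, subst sum.cartesian_product, intro sum.cong refl)
       (auto simp: vec prod mult.assoc simp del: fun_upd_apply vupd_nth insert_iff)
qed

text \<open>Induction on the set of interpolated coordinates. With \<open>h = (1 / N) ^ n\<close>, a
  new coordinate multiplies the old error by at most \<open>leb_const n - 1\<close> and adds at most
  \<open>leb_const n * h\<close>; the bound is chosen to satisfy this recursion.\<close>

lemma tensor_error: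
  fixes f :: "real^'d::finite \<Rightarrow> real"
  assumes f: "f \<in> sobolev_class n" and n: "n \<ge> 1" and N: "N \<ge> 1" and x: "x \<in> unit_cube"
  shows "\<bar>tensor n N S f x - f x\<bar> \<le> leb_const n * (1 + leb_const n) ^ card S * (1 / N) ^ n"
proof -
  let ?\<Lambda> = "leb_const n" and ?h = "(1 / real N) ^ n"
  have "finite S" by simp
  then show ?thesis using x
  proof (induction S arbitrary: x rule: finite_induct)
    case empty
    then show ?case using leb_const_ge_1[of n] by (simp add: tensor_def)
  next
    case (insert i S)
    have xi: "0 \<le> x $ i" "x $ i \<le> 1" using insert.prems by (auto simp: mem_unit_cube)
    obtain m t where mt: "m < N" "0 \<le> t" "t \<le> 1" "x $ i = (real m + t) / N"
      "\<forall>g. (\<Sum>q\<in>cells n N. icoef n q * ibasis N q (x $ i) * g (inode n N q)) =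
        (\<Sum>k\<le>n. poly (lag n k) t * g ((real m + real k / n) / N))"
      using interpolant_on_cell[OF n N xi] by blast
    let ?P = "\<lambda>k. vupd x i ((real m + real k / n) / N)"
    have P: "?P k \<in> unit_cube" if "k \<le> n" for k
    proof -
      have "(m, k, 0) \<in> cells n N" using mt(1) that by (simp add: cells_def)
      from inode_bounds[OF this] insert.prems show ?thesis
        unfolding mem_unit_cube by (simp add: inode_def)
    qed
    let ?E = "?\<Lambda> * (1 + ?\<Lambda>) ^ card S * ?h"
    have T: "tensor n N (insert i S) f x = (\<Sum>k\<le>n. poly (lag n k) t * tensor n N S f (?P k))"
      unfolding tensor_insert[OF insert.hyps(2)] by (rule mt(5)[rule_format, of "\<lambda>z. tensor n N S f (vupd x i z)"])
    have 1: "\<bar>\<Sum>k\<le>n. poly (lag n k) t * (tensor n N S f (?P k) - f (?P k))\<bar> \<le> (?\<Lambda> - 1) * ?E"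
    proof -
      have "\<bar>\<Sum>k\<le>n. poly (lag n k) t * (tensor n N S f (?P k) - f (?P k))\<bar> \<le> (\<Sum>k\<le>n. \<bar>poly (lag n k) t\<bar> * ?E)"
        using insert.IH[OF P] by (intro order_trans[OF sum_abs] sum_mono) (auto simp: abs_mult intro!: mult_left_mono)
      also have "\<dots> \<le> (?\<Lambda> - 1) * ?E"
        unfolding sum_distrib_right[symmetric] using sum_abs_lag_le[OF mt(2,3), of n] leb_const_ge_1[of n]
        by (intro mult_right_mono) auto
      finally show ?thesis .
    qed
    have 2: "\<bar>(\<Sum>k\<le>n. poly (lag n k) t * f (?P k)) - f x\<bar> \<le> ?\<Lambda> * ?h"
    proof -
      \<comment> \<open>The error in direction \<open>i\<close> as a functional: index
        \<open>Suc n\<close> stands for the point \<open>x\<close> itself, with weight -1.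
        Polynomials of degree less than \<open>n\<close> are annihilated because interpolation
        reproduces them.\<close>
      let ?w = "\<lambda>k. if k \<le> n then poly (lag n k) t else - 1"
      let ?s = "\<lambda>k. if k \<le> n then real k / n else t"
      let ?a = "real m / N" and ?b = "real (Suc m) / N"
      have ba: "?b - ?a = 1 / N" by (simp add: diff_divide_distrib[symmetric])
      have b1: "?b \<le> 1" using mt(1) by simp
      have pt: "?a + (?b - ?a) * s = (real m + s) / N" for s
        unfolding ba by (simp add: add_divide_distrib)
      have bound: "\<bar>\<Sum>k\<le>Suc n. ?w k * f (vupd x i (?a + (?b - ?a) * ?s k))\<bar> \<le> (\<Sum>k\<le>Suc n. \<bar>?w k\<bar>) * (?b - ?a) ^ n"
      proof (rule annihilator_bound[OF f n insert.prems])
        show "0 \<le> ?s k \<and> ?s k \<le> 1" if "k \<in> {..Suc n}" for k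
          using mt(2,3) by (auto simp: divide_le_eq)
        show "(\<Sum>k\<le>Suc n. ?w k * ?s k ^ j) = 0" if "j < n" for j
          using lag_reproduces[OF n, of "monom 1 j" t] that
          by (simp add: poly_monom degree_monom_eq mult.commute)
      qed (use N b1 in \<open>simp_all add: divide_strict_right_mono\<close>)
      have xx: "vupd x i ((real m + t) / N) = x" by (simp add: vec_eq_iff mt(4))
      have "\<bar>(\<Sum>k\<le>n. poly (lag n k) t * f (?P k)) - f x\<bar> \<le> ((\<Sum>k\<le>n. \<bar>poly (lag n k) t\<bar>) + 1) * ?h"
        using bound[unfolded pt, unfolded ba] by (simp add: xx)
      also have "\<dots> \<le> ?\<Lambda> * ?h"
        by (intro mult_right_mono sum_abs_lag_le mt) auto
      finally show ?thesis .
    qed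
    have h0: "0 \<le> ?h" by simp
    have "\<bar>tensor n N (insert i S) f x - f x\<bar> \<le> (?\<Lambda> - 1) * ?E + ?\<Lambda> * ?h"
      using 1 2 unfolding T by (simp add: right_diff_distrib sum_subtractf)
    also have "\<dots> = ?\<Lambda> * ?h * ((?\<Lambda> - 1) * (1 + ?\<Lambda>) ^ card S + 1)"
      by (simp add: algebra_simps)
    also have "\<dots> \<le> ?\<Lambda> * ?h * (1 + ?\<Lambda>) ^ Suc (card S)"
    proof (rule mult_left_mono)
      have "1 \<le> (1 + ?\<Lambda>) ^ card S" using leb_const_ge_1[of n] by simp
      then have "1 \<le> 2 * (1 + ?\<Lambda>) ^ card S" by linarith
      then show "(?\<Lambda> - 1) * (1 + ?\<Lambda>) ^ card S + 1 \<le> (1 + ?\<Lambda>) ^ Suc (card S)"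
        by (simp add: algebra_simps)
    qed (use leb_const_ge_1[of n] in auto)
    finally show ?case
      using insert.hyps by (simp add: mult_ac)
  qed
qed

section \<open>Register programs\<close>

text \<open>A column of the network is a straight-line program on finitely many nonnegative registers.
  A layer assigns to every register a list of (source register, weight) pairs; in the network every
  register is present in 24 identical copies, and the entry at list position \<open>c\<close> is read off copy
  \<open>c\<close>. In this way a register can be read with weight \<open>1 = 1/\<lambda> + (\<lambda>-1)/\<lambda>\<close>.\<close>

datatype slot = Fst | Snd | Both

text \<open>\<open>Coord\<close> and \<open>Coord'\<close> receive the two parts of an input
  coordinate, \<open>Unit\<close> holds 1, \<open>Acc\<close> the running product,
  \<open>Arg\<close> the number to be scaled by a constant, \<open>Gate\<close> its multiple by a
  digit. \<open>Sq\<close>, \<open>Tooth\<close> and \<open>Knee\<close> serve three squarings in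
  parallel, one for each of \<open>x\<close>, \<open>y\<close> and \<open>x + y\<close>.\<close>

datatype 'd reg = Coord 'd | Coord' 'd | Unit | Acc | Arg | Gate | Sq slot | Tooth slot | Knee slot

instance slot :: finite
proof
  have "(UNIV :: slot set) = {Fst, Snd, Both}" using slot.exhaust by blast
  then show "finite (UNIV :: slot set)" by (metis finite.simps)
qed

instance reg :: (finite) finite
proof
  have "r \<in> range Coord \<union> range Coord' \<union> {Unit, Acc, Arg, Gate} \<union> range Sq \<union> range Tooth \<union> range Knee"
    for r :: "'a reg" by (cases r) auto
  then have "(UNIV :: 'a reg set) =
      range Coord \<union> range Coord' \<union> {Unit, Acc, Arg, Gate} \<union> range Sq \<union> range Tooth \<union> range Knee" by blast
  moreover have "finite \<dots>" by simp
  ultimately show "finite (UNIV :: 'a reg set)" by (rule ssubst)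
qed

definition lin :: "('r \<times> real) list \<Rightarrow> ('r \<Rightarrow> real) \<Rightarrow> real" where
  "lin es v = (\<Sum>(s, w)\<leftarrow>es. w * v s)"

definition step :: "('r \<Rightarrow> ('r \<times> real) list) \<Rightarrow> ('r \<Rightarrow> real) \<Rightarrow> 'r \<Rightarrow> real" where
  "step L v = (\<lambda>r. max 0 (lin (L r) v))"

definition run :: "('r \<Rightarrow> ('r \<times> real) list) list \<Rightarrow> ('r \<Rightarrow> real) \<Rightarrow> 'r \<Rightarrow> real" where
  "run Ls v = fold step Ls v"

text \<open>The layer stripped of its weights, that is, the part that must not depend on the target
  function.\<close>

definition srcs :: "('r \<Rightarrow> ('r \<times> real) list) \<Rightarrow> 'r \<Rightarrow> 'r list" where
  "srcs L r = map fst (L r)"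

text \<open>The bound 24 is attained by the \<open>Sq\<close> rows of \<open>tooth_layer\<close>:
  twice four readings with weight 1, at two entries each, and eight with weight -1.\<close>

definition layer_ok :: "nat \<Rightarrow> ('r \<Rightarrow> ('r \<times> real) list) \<Rightarrow> bool" where
  "layer_ok lam L \<longleftrightarrow> (\<forall>r. length (L r) \<le> 24 \<and> snd ` set (L r) \<subseteq> qweights lam)"

definition nonneg :: "('r \<Rightarrow> real) \<Rightarrow> bool" where
  "nonneg v \<longleftrightarrow> (\<forall>r. 0 \<le> v r)"

lemma lin_simps [simp]:
  "lin [] v = 0" "lin ((s, w) # es) v = w * v s + lin es v" "lin (es @ fs) v = lin es v + lin fs v"
  by (simp_all add: lin_def)

lemma run_simps [simp]:
  "run [] v = v" "run (L # Ls) v = run Ls (step L v)" "run (Ls @ Ms) v = run Ms (run Ls v)"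
  by (simp_all add: run_def)

lemma nonneg_step: "nonneg (step L v)"
  by (simp add: nonneg_def step_def)

lemma nonneg_run: "nonneg v \<Longrightarrow> nonneg (run Ls v)"
  by (induction Ls arbitrary: v) (simp_all add: nonneg_step)

lemma real_div_bounds:
  fixes a k :: nat
  assumes "0 < k"
  shows "real (a div k) * real k \<le> real a" "real a \<le> (real (a div k) + 1) * real k"
proof -
  have "real a = real (a div k) * real k + real (a mod k)"
    by (metis div_mult_mod_eq of_nat_add of_nat_mult)
  moreover have "real (a mod k) \<le> real k" using assms by (simp add: less_imp_le)
  ultimately show "real (a div k) * real k \<le> real a" "real a \<le> (real (a div k) + 1) * real k"
    by (simp_all add: algebra_simps)
qed

locale quant =
  fixes lam :: nat
  assumes lam: "2 \<le> lam"
begin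

definition pos :: "nat \<Rightarrow> 'r \<Rightarrow> ('r \<times> real) list" where
  "pos c s = concat (replicate c [(s, 1 / real lam), (s, (real lam - 1) / real lam)])"

definition neg :: "nat \<Rightarrow> 'r \<Rightarrow> ('r \<times> real) list" where
  "neg c s = replicate c (s, - 1)"

lemma lin_pos [simp]: "lin (pos c s) v = real c * v s"
proof (induction c)
  case (Suc c)
  have "1 / real lam * v s + (real lam - 1) / real lam * v s = v s"
    using lam by (simp add: field_simps)
  with Suc show ?case by (simp add: pos_def algebra_simps)
qed (simp add: pos_def)

lemma lin_neg [simp]: "lin (neg c s) v = - (real c * v s)"
  by (induction c) (simp_all add: neg_def algebra_simps)

lemma length_pos [simp]: "length (pos c s) = 2 * c"
  by (induction c) (simp_all add: pos_def)

lemma length_neg [simp]: "length (neg c s) = c"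
  by (simp add: neg_def)

lemma qweights_digit: "1 \<le> k \<Longrightarrow> k < lam \<Longrightarrow> real k / real lam \<in> qweights lam"
  by (auto simp: qweights_def)

lemma qweights_basic [simp]:
  "- 1 \<in> qweights lam" "1 / real lam \<in> qweights lam" "(real lam - 1) / real lam \<in> qweights lam"
  using qweights_digit[of 1] qweights_digit[of "lam - 1"] lam
  by (auto simp: qweights_def of_nat_diff)

lemma pos_weight: "(r, w) \<in> set (pos c s) \<Longrightarrow> w \<in> qweights lam"
  by (induction c) (auto simp: pos_def)

lemma neg_weight: "(r, w) \<in> set (neg c s) \<Longrightarrow> w \<in> qweights lam"
  by (auto simp: neg_def)

subsection \<open>Reading the coordinates\<close>

text \<open>No single admissible weight or bias is 1, so a coordinate and the constant 1 arrive
  split into the fractions \<open>1 / lam\<close> and \<open>(lam - 1) / lam\<close> and are put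
  together here.\<close>

definition merge_layer :: "'d reg \<Rightarrow> ('d reg \<times> real) list" where
  "merge_layer r = (case r of Coord i \<Rightarrow> pos 1 (Coord i) @ pos 1 (Coord' i)
     | Unit \<Rightarrow> pos 1 Unit @ pos 1 Acc | _ \<Rightarrow> [])"

definition double_layer :: "('d \<Rightarrow> nat) \<Rightarrow> 'd reg \<Rightarrow> ('d reg \<times> real) list" where
  "double_layer b r = (case r of Coord i \<Rightarrow> pos 2 (Coord i) @ neg (b i mod 2) Unit | _ \<Rightarrow> pos 1 r)"

text \<open>Applied twice, \<open>y \<mapsto> max 0 (1 - y)\<close> is \<open>min 1 y\<close> for
  nonnegative \<open>y\<close>; this is the upper half of the clipping.\<close>

definition flip_layer :: "'d reg \<Rightarrow> ('d reg \<times> real) list" where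
  "flip_layer r = (case r of Coord i \<Rightarrow> pos 1 Unit @ neg 1 (Coord i) | _ \<Rightarrow> pos 1 r)"

definition start_layer :: "'d reg \<Rightarrow> ('d reg \<times> real) list" where
  "start_layer r = (if r = Acc then pos 1 Unit else pos 1 r)"

text \<open>Computes \<open>2\<^sup>s x - m\<close> by doubling and subtracting the binary digits of \<open>m\<close>, most
  significant first; clipping the intermediate values at 0 is harmless because they only decrease
  below 0.\<close>

fun zoom_prog :: "nat \<Rightarrow> ('d \<Rightarrow> nat) \<Rightarrow> ('d reg \<Rightarrow> ('d reg \<times> real) list) list" where
  "zoom_prog 0 b = []"
| "zoom_prog (Suc s) b = zoom_prog s (\<lambda>i. b i div 2) @ [double_layer b]"

lemma run_zoom:
  assumes "nonneg v" "v Unit = 1" "\<And>i. b i < 2 ^ s"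
  shows "run (zoom_prog s b) v (Coord i) = max 0 (2 ^ s * v (Coord i) - real (b i))"
    and "run (zoom_prog s b) v Unit = 1"
proof -
  have "run (zoom_prog s b) v Unit = 1 \<and>
      (\<forall>i. run (zoom_prog s b) v (Coord i) = max 0 (2 ^ s * v (Coord i) - real (b i)))"
    using assms(3)
  proof (induction s arbitrary: b)
    case 0
    then show ?case using assms by (simp add: nonneg_def)
  next
    case (Suc s)
    have "b i div 2 < 2 ^ s" for i using Suc.prems[of i] by simp
    note IH = Suc.IH[of "\<lambda>i. b i div 2", OF this]
    have "real (b i) = 2 * real (b i div 2) + real (b i mod 2)" for i
      by (metis mult_div_mod_eq of_nat_add of_nat_mult of_nat_numeral)
    then have "max 0 (2 * max 0 (2 ^ s * v (Coord i) - real (b i div 2)) - real (b i mod 2)) =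
        max 0 (2 ^ Suc s * v (Coord i) - real (b i))" for i
      by (auto simp: max_def algebra_simps)
    then show ?case using IH by (simp add: step_def double_layer_def)
  qed
  then show "run (zoom_prog s b) v (Coord i) = max 0 (2 ^ s * v (Coord i) - real (b i))"
    "run (zoom_prog s b) v Unit = 1" by auto
qed

subsection \<open>Multiplication by a constant\<close>

definition gate_layer :: "nat \<Rightarrow> 'd reg \<Rightarrow> ('d reg \<times> real) list" where
  "gate_layer k r = (if r = Gate then [(Arg, if k = 0 then - 1 else real k / real lam)] else pos 1 r)"

definition accum_layer :: "'d reg \<Rightarrow> ('d reg \<times> real) list" where
  "accum_layer r = (if r = Acc then (Acc, 1 / real lam) # pos 1 Gate else pos 1 r)"

text \<open>Horner's scheme for the base-\<open>\<lambda>\<close> digits of \<open>p\<close>. The weight \<open>-1\<close> stands for the digit 0,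
  since the argument is nonnegative and ReLU cuts off the product.\<close>

fun scale_prog :: "nat \<Rightarrow> nat \<Rightarrow> ('d reg \<Rightarrow> ('d reg \<times> real) list) list" where
  "scale_prog 0 p = []"
| "scale_prog (Suc S) p = gate_layer (p mod lam) # accum_layer # scale_prog S (p div lam)"

text \<open>The least significant digit comes first, since every later step divides the accumulated
  value by \<open>lam\<close> once more. The initial content of \<open>Acc\<close> is divided as
  well, which is why \<open>combine_layer\<close> and \<open>move_layer\<close> clear it.\<close>

lemma run_scale:
  assumes "nonneg v" "p < lam ^ S"
  shows "run (scale_prog S p) v Acc = (v Acc + real p * v Arg) / real lam ^ S \<and>
    (\<forall>r. r \<noteq> Acc \<and> r \<noteq> Gate \<longrightarrow> run (scale_prog S p) v r = v r)"
  using assms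
proof (induction S arbitrary: p v)
  case (Suc S)
  define k where "k = p mod lam"
  define v' where "v' = step accum_layer (step (gate_layer k) v)"
  have lam0: "0 < real lam" using lam by simp
  have v: "0 \<le> v r" for r using Suc.prems(1) by (simp add: nonneg_def)
  have vG: "step (gate_layer k) v = v(Gate := real k / real lam * v Arg)"
    using v by (auto simp: step_def gate_layer_def)
  have v': "v' = v(Gate := real k / real lam * v Arg, Acc := v Acc / real lam + real k / real lam * v Arg)"
    unfolding v'_def vG using v lam0 by (auto simp: step_def accum_layer_def)
  have "nonneg v'" unfolding v'_def by (rule nonneg_step)
  moreover have "p div lam < lam ^ S"
    using Suc.prems(2) lam by (simp add: less_mult_imp_div_less mult.commute)
  ultimately have IH: "run (scale_prog S (p div lam)) v' Acc = (v' Acc + real (p div lam) * v' Arg) / real lam ^ S"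
    "\<And>r. r \<noteq> Acc \<Longrightarrow> r \<noteq> Gate \<Longrightarrow> run (scale_prog S (p div lam)) v' r = v' r"
    using Suc.IH by blast+
  have "real p = real k + real lam * real (p div lam)"
    unfolding k_def by (metis mod_mult_div_eq of_nat_add of_nat_mult)
  then have "(v' Acc + real (p div lam) * v' Arg) / real lam ^ S = (v Acc + real p * v Arg) / real lam ^ Suc S"
    using lam0 by (simp add: v' field_simps)
  then show ?case using IH by (simp add: v'_def[symmetric] k_def[symmetric]) (simp add: v')
qed simp

lemma srcs_gate: "srcs (gate_layer k) = srcs (gate_layer k')"
  by (auto simp: srcs_def gate_layer_def)

text \<open>Digits enter as weights only, the digit 0 included, so the topology is the same for all
  constants.\<close>

lemma srcs_scale: "map srcs (scale_prog S p) = map srcs (scale_prog S p')"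
proof (induction S arbitrary: p p')
  case (Suc S)
  show ?case
    by (simp only: scale_prog.simps list.map srcs_gate[of "p mod lam" "p' mod lam"]
        Suc[of "p div lam" "p' div lam"])
qed simp

lemma length_scale [simp]: "length (scale_prog S p) = 2 * S"
  by (induction S arbitrary: p) auto

subsection \<open>Approximate products\<close>

definition load :: "'d reg \<Rightarrow> slot \<Rightarrow> ('d reg \<times> real) list" where
  "load F s = (case s of Fst \<Rightarrow> pos 1 Acc | Snd \<Rightarrow> pos 1 F | Both \<Rightarrow> pos 1 Acc @ pos 1 F)"

definition load_layer :: "'d reg \<Rightarrow> 'd reg \<Rightarrow> ('d reg \<times> real) list" where
  "load_layer F r = (case r of Sq s \<Rightarrow> [] | Tooth s \<Rightarrow> load F s | Knee s \<Rightarrow> load F s @ neg 1 Unit | _ \<Rightarrow> pos 1 r)"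

text \<open>The tent map is \<open>g u = 2 u - 4 max 0 (u - 1)\<close>, and \<open>Knee\<close>
  holds \<open>max 0 (u - 1)\<close>. So \<open>Sq\<close> becomes \<open>4 Sq + 2 g u\<close>, and
  the knee of the next iterate is formed from the old registers in the same layer.\<close>

definition tooth_layer :: "'d reg \<Rightarrow> ('d reg \<times> real) list" where
  "tooth_layer r = (case r of Sq s \<Rightarrow> pos 4 (Sq s) @ pos 4 (Tooth s) @ neg 8 (Knee s)
     | Tooth s \<Rightarrow> pos 2 (Tooth s) @ neg 4 (Knee s)
     | Knee s \<Rightarrow> pos 2 (Tooth s) @ neg 4 (Knee s) @ neg 1 Unit
     | _ \<Rightarrow> pos 1 r)"

text \<open>The three squares are too small by amounts in [0, 1]. Subtracting 1 makes up for the one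
  that enters negatively, so the result never exceeds the true value.\<close>

definition combine_layer :: "'d reg \<Rightarrow> ('d reg \<times> real) list" where
  "combine_layer r = (case r of Arg \<Rightarrow> pos 1 (Sq Fst) @ pos 1 (Sq Snd) @ neg 1 (Sq Both) @ neg 1 Unit
     | Acc \<Rightarrow> [] | _ \<Rightarrow> pos 1 r)"

definition move_layer :: "'d reg \<Rightarrow> ('d reg \<times> real) list" where
  "move_layer r = (case r of Arg \<Rightarrow> pos 1 Acc | Acc \<Rightarrow> [] | _ \<Rightarrow> pos 1 r)"

text \<open>With \<open>H u = u (2 - u)\<close> one has \<open>2 x y = H x + H y - H (x + y)\<close>, and for the tent map \<open>g\<close> on
  \<open>[0, 2]\<close> the recursion \<open>4 H u = 2 g u + H (g u)\<close>. Hence \<open>m\<close> tooth layers compute \<open>4\<^sup>m H u\<close> up to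
  an error in \<open>[0, 1]\<close> using integer weights only; the final factor \<open>1 / (2 * 4\<^sup>m)\<close> is rounded down.\<close>

definition mult_prog :: "nat \<Rightarrow> 'd reg \<Rightarrow> ('d reg \<Rightarrow> ('d reg \<times> real) list) list" where
  "mult_prog m F = load_layer F # replicate m tooth_layer @ combine_layer #
     scale_prog (4 * m) (lam ^ (4 * m) div (2 * 4 ^ m))"

definition H :: "real \<Rightarrow> real" where "H u = u * (2 - u)"

text \<open>The recursion for \<open>H\<close> unrolled \<open>k\<close> times: \<open>H\<close> of
  the current iterate is the part not yet added to \<open>Sq\<close>, and it lies in [0, 1].\<close>

definition tooth_inv :: "(slot \<Rightarrow> real) \<Rightarrow> nat \<Rightarrow> ('d reg \<Rightarrow> real) \<Rightarrow> bool" where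
  "tooth_inv u k v \<longleftrightarrow> v Unit = 1 \<and> nonneg v \<and> (\<forall>s. v (Tooth s) \<le> 2 \<and>
     v (Knee s) = max 0 (v (Tooth s) - 1) \<and> v (Sq s) = 4 ^ k * H (u s) - H (v (Tooth s)))"

lemma tooth_inv_step:
  assumes "tooth_inv u k v"
  shows "tooth_inv u (Suc k) (step tooth_layer v)"
proof -
  let ?v = "step tooth_layer v"
  have v: "0 \<le> v r" for r using assms by (simp add: tooth_inv_def nonneg_def)
  have "?v (Tooth s) \<le> 2 \<and> ?v (Knee s) = max 0 (?v (Tooth s) - 1) \<and>
      ?v (Sq s) = 4 ^ Suc k * H (u s) - H (?v (Tooth s))" for s
  proof -
    define p where "p = v (Tooth s)"
    define a where "a = v (Sq s)"
    have p: "0 \<le> p" "p \<le> 2" "v (Knee s) = max 0 (p - 1)" and a: "0 \<le> a"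
      and H: "4 ^ k * H (u s) = a + H p"
      using assms v[of "Sq s"] v[of "Tooth s"] by (auto simp: tooth_inv_def p_def a_def)
    have U: "v Unit = 1" using assms by (simp add: tooth_inv_def)
    have H': "4 ^ Suc k * H (u s) = 4 * a + 4 * H p" using H by simp
    show ?thesis unfolding H'
    proof (cases "p \<le> 1")
      case True
      then have K: "v (Knee s) = 0" using p(3) by simp
      show "?v (Tooth s) \<le> 2 \<and> ?v (Knee s) = max 0 (?v (Tooth s) - 1) \<and>
          ?v (Sq s) = 4 * a + 4 * H p - H (?v (Tooth s))"
        using p(1,2) a True by (simp add: K step_def tooth_layer_def U p_def[symmetric] a_def[symmetric] H_def algebra_simps)
    next
      case False
      then have K: "v (Knee s) = p - 1" using p(3) by simp
      show "?v (Tooth s) \<le> 2 \<and> ?v (Knee s) = max 0 (?v (Tooth s) - 1) \<and>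
          ?v (Sq s) = 4 * a + 4 * H p - H (?v (Tooth s))"
        using p(1,2) a False by (simp add: K step_def tooth_layer_def U p_def[symmetric] a_def[symmetric] H_def algebra_simps)
    qed
  qed
  then show ?thesis
    using assms nonneg_step[of tooth_layer v] v by (simp add: tooth_inv_def step_def tooth_layer_def)
qed

lemma run_tooth:
  assumes "tooth_inv u k v"
  shows "tooth_inv u (k + m) (run (replicate m tooth_layer) v)"
    and "run (replicate m tooth_layer) v (Coord i) = v (Coord i)"
  using assms
proof (induction m arbitrary: v k)
  case (Suc m)
  {
    case 1
    show ?case using Suc(1)[OF tooth_inv_step[OF 1]] by simp
  next
    case 2
    then have "step tooth_layer v (Coord i) = v (Coord i)"
      by (simp add: step_def tooth_layer_def tooth_inv_def nonneg_def)
    then show ?case using Suc(2)[OF tooth_inv_step[OF 2]] by simp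
  }
qed simp_all

definition good :: "('d \<Rightarrow> real) \<Rightarrow> ('d reg \<Rightarrow> real) \<Rightarrow> bool" where
  "good t v \<longleftrightarrow> nonneg v \<and> v Unit = 1 \<and> (\<forall>i. v (Coord i) = t i) \<and> v Acc \<le> 1"

fun rval :: "('d \<Rightarrow> real) \<Rightarrow> 'd reg \<Rightarrow> real" where
  "rval t (Coord i) = t i"
| "rval t r = 1"

text \<open>The upper bound keeps \<open>Acc\<close> in [0, 1] for the next multiplication. Before
  scaling at most 3 is lost, which becomes \<open>3 / (2 * 4 ^ m)\<close>; rounding the scaling
  constant costs at most \<open>2 / 4 ^ m\<close>.\<close>

lemma run_mult:
  fixes m :: nat
  assumes v: "good t v" and t: "\<And>i. 0 \<le> t i \<and> t i \<le> 1" and F: "F = Unit \<or> F \<in> range Coord"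
  defines "v' \<equiv> run (mult_prog m F) v"
  shows "good t v'" "v' Acc \<le> v Acc * rval t F" "v Acc * rval t F - 4 / 4 ^ m \<le> v' Acc"
proof -
  define x y where "x = v Acc" and "y = v F"
  have v0: "0 \<le> v r" for r using v by (simp add: good_def nonneg_def)
  have U: "v Unit = 1" using v by (simp add: good_def)
  have x: "0 \<le> x" "x \<le> 1" using v v0 by (auto simp: x_def good_def)
  have y: "0 \<le> y" "y \<le> 1" "rval t F = y" using v F t by (auto simp: y_def good_def)
  define u where "u s = (case s of Fst \<Rightarrow> x | Snd \<Rightarrow> y | Both \<Rightarrow> x + y)" for s
  define v1 where "v1 = step (load_layer F) v"
  have "0 \<le> u s" "u s \<le> 2" for s using x y by (auto simp: u_def split: slot.split)
  moreover have "lin (load F s) v = u s" for s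
    by (simp add: load_def u_def x_def y_def split: slot.split)
  ultimately have "tooth_inv u 0 v1"
    using nonneg_step[of "load_layer F" v] U
    by (simp add: tooth_inv_def v1_def) (simp add: step_def load_layer_def U)
  moreover have "v1 (Coord i) = t i" for i
    using v t by (simp add: v1_def step_def load_layer_def good_def)
  moreover define v2 where "v2 = run (replicate m tooth_layer) v1"
  ultimately have inv: "tooth_inv u m v2" and c2: "\<And>i. v2 (Coord i) = t i"
    using run_tooth[of u 0 v1 m] by auto
  have v20: "0 \<le> v2 r" for r using inv by (simp add: tooth_inv_def nonneg_def)
  define e where "e s = H (v2 (Tooth s))" for s
  have e: "0 \<le> e s" "e s \<le> 1" for s
  proof -
    have *: "0 \<le> v2 (Tooth s)" "v2 (Tooth s) \<le> 2" using inv v20 by (auto simp: tooth_inv_def)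
    then show "0 \<le> e s" by (simp add: e_def H_def)
    have "1 - e s = (v2 (Tooth s) - 1)\<^sup>2" by (simp add: e_def H_def power2_eq_square algebra_simps)
    then show "e s \<le> 1" by (metis diff_ge_0_iff_ge zero_le_power2)
  qed
  have Sq: "v2 (Sq s) = 4 ^ m * H (u s) - e s" for s using inv by (simp add: tooth_inv_def e_def)
  define v3 where "v3 = step combine_layer v2"
  define Y where "Y = v3 Arg"
  have "H (u Fst) + H (u Snd) - H (u Both) = 2 * (x * y)"
    by (simp add: u_def H_def algebra_simps)
  then have "4 ^ m * H (u Fst) + 4 ^ m * H (u Snd) - 4 ^ m * H (u Both) = 4 ^ m * (2 * (x * y))"
    by (metis distrib_left right_diff_distrib)
  then have Y': "Y = max 0 (4 ^ m * (2 * (x * y)) - e Fst - e Snd + e Both - 1)"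
    using inv by (simp add: Y_def v3_def step_def combine_layer_def Sq tooth_inv_def algebra_simps)
  have xy: "0 \<le> x * y" "x * y \<le> 1" using x y by (auto intro: mult_le_one)
  then have P0: "0 \<le> (4::real) ^ m * (2 * (x * y))" by simp
  have Y: "0 \<le> Y" "Y \<le> 4 ^ m * (2 * (x * y))" "4 ^ m * (2 * (x * y)) - 3 \<le> Y"
    using e[of Fst] e[of Snd] e[of Both] P0 unfolding Y' by auto
  define S where "S = 4 * m"
  define p where "p = lam ^ S div (2 * 4 ^ m)"
  define q where "q = real p / real lam ^ S"
  have lamS: "0 < real lam ^ S" using lam by simp
  have "p \<le> lam ^ S div 2" unfolding p_def by (simp add: div_le_mono2)
  also have "\<dots> < lam ^ S" using lam by simp
  finally have pS: "p < lam ^ S" .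
  have q1: "q \<le> 1 / (2 * 4 ^ m)"
  proof -
    have "real p * (2 * 4 ^ m) \<le> real lam ^ S"
      using real_div_bounds(1)[of "2 * 4 ^ m" "lam ^ S"] by (simp add: p_def)
    then show ?thesis using lamS by (simp add: q_def field_simps)
  qed
  \<comment> \<open>Since \<open>lam\<close> is at least 2, \<open>4 * m\<close> digits resolve
    \<open>1 / 16 ^ m\<close>. The rounding error is multiplied by \<open>Y\<close>, which is
    bounded only by \<open>2 * 4 ^ m\<close>.\<close>
  have q2: "1 / (2 * 4 ^ m) - 1 / 16 ^ m \<le> q"
  proof -
    have "real lam ^ S \<le> (real p + 1) * (2 * 4 ^ m)"
      using real_div_bounds(2)[of "2 * 4 ^ m" "lam ^ S"] by (simp add: p_def)
    moreover have "1 / K - 1 / L \<le> P / L" if "L \<le> (P + 1) * K" "0 < L" "0 < K" for K L P :: real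
    proof -
      have "1 / K \<le> (P + 1) / L" using that by (simp add: pos_le_divide_eq pos_divide_le_eq)
      then show ?thesis by (simp add: add_divide_distrib)
    qed
    ultimately have "1 / (2 * 4 ^ m) - 1 / real lam ^ S \<le> q" using lamS by (simp add: q_def)
    moreover have "(16::real) ^ m \<le> real lam ^ S"
    proof -
      have "(16::real) ^ m = 2 ^ S" by (simp add: S_def power_mult)
      also have "\<dots> \<le> real lam ^ S" using lam by (intro power_mono) auto
      finally show ?thesis .
    qed
    then have "1 / real lam ^ S \<le> 1 / 16 ^ m" by (intro divide_left_mono) (use lam in auto)
    ultimately show ?thesis by linarith
  qed
  have n3: "nonneg v3" unfolding v3_def by (rule nonneg_step)
  have v'3: "v' = run (scale_prog S p) v3"
    by (simp add: v'_def mult_prog_def v3_def v2_def v1_def S_def p_def)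
  have "v3 Acc = 0" by (simp add: v3_def step_def combine_layer_def)
  then have Acc: "v' Acc = q * Y"
    using run_scale[OF n3 pS] by (simp add: v'3 q_def Y_def)
  have rest: "v' r = v3 r" if "r \<noteq> Acc" "r \<noteq> Gate" for r
    using run_scale[OF n3 pS] that by (simp add: v'3)
  have q0: "0 \<le> q" by (simp add: q_def)
  have "q * Y \<le> 1 / (2 * 4 ^ m) * (4 ^ m * (2 * (x * y)))"
    using q1 Y by (intro mult_mono) auto
  then show up: "v' Acc \<le> v Acc * rval t F" by (simp add: Acc y x_def)
  have "x * y - 4 / 4 ^ m \<le> q * Y"
  proof -
    have m4: "(16::real) ^ m = 4 ^ m * 4 ^ m" by (simp flip: power_mult_distrib)
    have "Y / 16 ^ m \<le> 4 ^ m * 2 / 16 ^ m"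
      using Y(2) xy(2) by (intro divide_right_mono) (auto elim: order_trans simp: mult_left_le)
    also have "\<dots> = 2 / 4 ^ m" by (simp add: m4)
    finally have 1: "Y / 16 ^ m \<le> 2 / 4 ^ m" .
    have 2: "x * y - 3 / (2 * 4 ^ m) \<le> Y / (2 * 4 ^ m)"
    proof -
      have "x * y \<le> (Y + 3) / (2 * 4 ^ m)" using Y(3) by (simp add: pos_le_divide_eq mult_ac)
      then show ?thesis by (simp add: add_divide_distrib)
    qed
    have "(1 / (2 * 4 ^ m) - 1 / 16 ^ m) * Y \<le> q * Y"
      using q2 Y(1) by (rule mult_right_mono)
    then have "Y / (2 * 4 ^ m) - Y / 16 ^ m \<le> q * Y" by (simp add: left_diff_distrib)
    moreover have "3 / (2 * 4 ^ m) + 2 / 4 ^ m \<le> 4 / (4::real) ^ m" by (simp add: field_simps)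
    ultimately show ?thesis using 1 2 by linarith
  qed
  then show "v Acc * rval t F - 4 / 4 ^ m \<le> v' Acc" by (simp add: Acc y x_def)
  show "good t v'"
  proof -
    have "v' Acc \<le> 1" using up xy(2) by (simp add: y x_def)
    moreover have "v3 Unit = 1" "v3 (Coord i) = t i" for i
      using inv c2 v20 t by (auto simp: v3_def step_def combine_layer_def tooth_inv_def)
    ultimately show ?thesis
      using nonneg_run[OF n3, of "scale_prog S p"] rest by (auto simp: good_def v'3[symmetric])
  qed
qed

definition prods_prog :: "nat \<Rightarrow> 'd reg list \<Rightarrow> ('d reg \<Rightarrow> ('d reg \<times> real) list) list" where
  "prods_prog m Fs = concat (map (mult_prog m) Fs)"

text \<open>Multiplying by factors from [0, 1] does not enlarge earlier errors, so the errors simply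
  add up.\<close>

lemma run_prods:
  fixes m :: nat and e :: real
  assumes "good t v" and t: "\<And>i. 0 \<le> t i \<and> t i \<le> 1" and "set Fs \<subseteq> insert Unit (range Coord)"
  defines "e \<equiv> 4 / 4 ^ m"
  shows "good t (run (prods_prog m Fs) v) \<and>
    run (prods_prog m Fs) v Acc \<le> v Acc * (\<Prod>F\<leftarrow>Fs. rval t F) \<and>
    v Acc * (\<Prod>F\<leftarrow>Fs. rval t F) - length Fs * e \<le> run (prods_prog m Fs) v Acc"
  using assms(1,3)
proof (induction Fs arbitrary: v)
  case (Cons F Fs)
  define v' where "v' = run (mult_prog m F) v"
  define R where "R = (\<Prod>F\<leftarrow>Fs. rval t F)"
  have rv: "0 \<le> rval t r \<and> rval t r \<le> 1" for r using t by (cases r) auto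
  have "0 \<le> R \<and> R \<le> 1" unfolding R_def by (induction Fs) (auto simp: rv intro!: mult_le_one)
  then have R: "0 \<le> R" "R \<le> 1" by auto
  have e: "0 \<le> e" by (simp add: e_def)
  have F: "F = Unit \<or> F \<in> range Coord" and s: "set Fs \<subseteq> insert Unit (range Coord)"
    using Cons.prems(2) by auto
  note m = run_mult[OF Cons.prems(1) t F, where m = m, folded v'_def e_def]
  have ru: "run (prods_prog m (F # Fs)) v = run (prods_prog m Fs) v'"
    by (simp add: prods_prog_def v'_def)
  note IH = Cons.IH[OF m(1) s]
  have "v' Acc * R \<le> v Acc * rval t F * R" using m(2) R by (intro mult_right_mono)
  moreover have "(v Acc * rval t F - e) * R \<le> v' Acc * R" using m(3) R by (intro mult_right_mono)
  moreover have "e * R \<le> e" using e R by (simp add: mult_left_le)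
  ultimately show ?case
    using IH unfolding ru R_def[symmetric] by (simp add: R_def[symmetric] algebra_simps)
qed (auto simp: prods_prog_def)

subsection \<open>A column\<close>

text \<open>Of all the arguments only \<open>p\<close> will depend on the target function.
  \<open>move_layer\<close> passes the finished product to \<open>Arg\<close>, where it is scaled by
  \<open>p / lam ^ S\<close>.\<close>

definition col_prog :: "nat \<Rightarrow> nat \<Rightarrow> ('d \<Rightarrow> nat) \<Rightarrow> 'd reg list \<Rightarrow> nat \<Rightarrow> nat \<Rightarrow>
    ('d reg \<Rightarrow> ('d reg \<times> real) list) list" where
  "col_prog s m b Fs S p = merge_layer # zoom_prog s b @ [flip_layer, flip_layer, start_layer] @
     prods_prog m Fs @ move_layer # scale_prog S p"

text \<open>The state of the first hidden layer, not of the inputs: one weighted reading of a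
  coordinate or one bias, already cut off by ReLU.\<close>

definition init :: "real^'d \<Rightarrow> 'd reg \<Rightarrow> real" where
  "init x r = max 0 (case r of Coord i \<Rightarrow> x $ i / lam | Coord' i \<Rightarrow> (real lam - 1) / lam * x $ i
     | Unit \<Rightarrow> 1 / lam | Acc \<Rightarrow> (real lam - 1) / lam | _ \<Rightarrow> 0)"

lemma run_col:
  assumes x: "\<And>i. 0 \<le> x $ i" and b: "\<And>i. b i < 2 ^ s" and p: "p < lam ^ S"
    and Fs: "set Fs \<subseteq> insert Unit (range Coord)"
  defines "R \<equiv> (\<Prod>F\<leftarrow>Fs. rval (\<lambda>i. min 1 (max 0 (2 ^ s * x $ i - real (b i)))) F)"
  obtains z where "run (col_prog s m b Fs S p) (init x) Acc = real p / real lam ^ S * z"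
    "z \<le> R" "R - length Fs * (4 / 4 ^ m) \<le> z"
proof -
  let ?t = "\<lambda>i. min 1 (max 0 (2 ^ s * x $ i - real (b i)))"
  have lam0: "0 < real lam" "1 \<le> real lam" using lam by simp_all
  define v1 where "v1 = step merge_layer (init x)"
  have "init x (Coord i) + init x (Coord' i) = x $ i" for i
  proof -
    have *: "init x (Coord i) = x $ i / lam" "init x (Coord' i) = (real lam - 1) / lam * x $ i"
      using x[of i] lam0 by (simp_all add: init_def)
    show ?thesis unfolding * using lam0 by (simp add: field_simps)
  qed
  moreover have "init x Unit + init x Acc = 1"
    using lam0 by (simp add: init_def max_def field_simps)
  ultimately have v1: "nonneg v1" "v1 Unit = 1" "\<And>i. v1 (Coord i) = x $ i"
    using x by (auto simp: v1_def nonneg_step) (auto simp: step_def merge_layer_def)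
  define v2 where "v2 = run (zoom_prog s b) v1"
  have v2: "nonneg v2" "v2 Unit = 1" "\<And>i. v2 (Coord i) = max 0 (2 ^ s * x $ i - real (b i))"
    using run_zoom[of v1 b s, OF v1(1,2) b] nonneg_run[OF v1(1)] v1(3) by (auto simp: v2_def)
  define v3 where "v3 = step start_layer (step flip_layer (step flip_layer v2))"
  have v20: "0 \<le> v2 r" for r using v2 by (simp add: nonneg_def)
  have Acc3: "v3 Acc = 1" and "v3 Unit = 1" "\<And>i. v3 (Coord i) = ?t i"
    using v2 by (auto simp: v3_def step_def start_layer_def flip_layer_def)
  then have v3: "good ?t v3" by (simp add: good_def v3_def nonneg_step)
  define v4 where "v4 = run (prods_prog m Fs) v3"
  have t: "0 \<le> ?t i \<and> ?t i \<le> 1" for i by simp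
  note pr = run_prods[OF v3 t Fs, where m = m, folded v4_def]
  define v5 where "v5 = step move_layer v4"
  have v5: "v5 Arg = v4 Acc" "v5 Acc = 0" "nonneg v5"
    using pr by (auto simp: v5_def step_def move_layer_def good_def nonneg_def)
  have "run (col_prog s m b Fs S p) (init x) Acc = real p / real lam ^ S * v4 Acc"
    using run_scale[OF v5(3) p] v5 by (simp add: col_prog_def v5_def v4_def v3_def v2_def v1_def)
  then show ?thesis using that[of "v4 Acc"] pr Acc3 by (simp add: R_def)
qed

lemma srcs_col: "map srcs (col_prog s m b Fs S p) = map srcs (col_prog s m b Fs S p')"
  by (simp add: col_prog_def srcs_scale[of S p p'])

lemma length_zoom [simp]: "length (zoom_prog s b) = s"
  by (induction s arbitrary: b) auto

lemma length_prods [simp]: "length (prods_prog m Fs) = length Fs * (9 * m + 2)"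
  by (induction Fs) (simp_all add: prods_prog_def mult_prog_def)

lemma length_col: "length (col_prog s m b Fs S p) = 5 + s + length Fs * (9 * m + 2) + 2 * S"
  by (simp add: col_prog_def)

lemma layer_ok_basic:
  "layer_ok lam merge_layer" "layer_ok lam (double_layer b)" "layer_ok lam flip_layer"
  "layer_ok lam start_layer" "layer_ok lam accum_layer" "layer_ok lam (load_layer F)"
  "layer_ok lam tooth_layer" "layer_ok lam combine_layer" "layer_ok lam move_layer"
  by (auto simp: layer_ok_def merge_layer_def double_layer_def flip_layer_def start_layer_def accum_layer_def
      load_layer_def tooth_layer_def combine_layer_def move_layer_def load_def
      dest: pos_weight neg_weight split: reg.split slot.split)

lemma layer_ok_gate: "k < lam \<Longrightarrow> layer_ok lam (gate_layer k)"
  by (auto simp: layer_ok_def gate_layer_def qweights_digit dest: pos_weight)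

lemma layer_ok_scale: "L \<in> set (scale_prog S p) \<Longrightarrow> layer_ok lam L"
  using lam by (induction S arbitrary: p) (auto simp: layer_ok_basic layer_ok_gate)

lemma layer_ok_zoom: "L \<in> set (zoom_prog s b) \<Longrightarrow> layer_ok lam L"
  by (induction s arbitrary: b) (auto simp: layer_ok_basic)

lemma layer_ok_col: "L \<in> set (col_prog s m b Fs S p) \<Longrightarrow> layer_ok lam L"
  by (auto simp: col_prog_def prods_prog_def mult_prog_def layer_ok_basic layer_ok_zoom layer_ok_scale
      split: if_splits)

end

section \<open>Compiling columns into a network\<close>

definition units :: "'c set \<Rightarrow> ('c \<times> 'r \<times> nat) set" where
  "units C = C \<times> UNIV \<times> {..<24}"

lemma finite_units: "finite C \<Longrightarrow> finite (units C :: ('c \<times> 'r::finite \<times> nat) set)"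
  by (simp add: units_def)

text \<open>The boolean \<open>\<sigma> \<kappa>\<close> tells whether column \<open>\<kappa>\<close> is added or subtracted by the output unit.\<close>

definition network :: "('c \<times> 'd reg \<times> nat \<Rightarrow> nat) \<Rightarrow> (nat \<Rightarrow> 'd::finite) \<Rightarrow> 'c set \<Rightarrow> ('c \<Rightarrow> bool) \<Rightarrow>
    nat \<Rightarrow> ('c \<Rightarrow> ('d reg \<Rightarrow> 'd reg list) list) \<Rightarrow> 'd arch" where
  "network enc \<iota> C \<sigma> D T = \<lparr>
     net_L = Suc (Suc D),
     width = (\<lambda>k. if k = 0 then CARD('d) else if k = Suc (Suc D) then 1 else card (units C :: ('c \<times> 'd reg \<times> nat) set)),
     edges = {(0, i, enc (\<kappa>, r, c)) | i \<kappa> r c. i < CARD('d) \<and> \<kappa> \<in> C \<and> c < 24 \<and> (r = Coord (\<iota> i) \<or> r = Coord' (\<iota> i))}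
       \<union> {(Suc l, enc (\<kappa>, (T \<kappa> ! l) r ! c', c'), enc (\<kappa>, r, c)) | l \<kappa> r c c'.
            l < D \<and> \<kappa> \<in> C \<and> c < 24 \<and> c' < length ((T \<kappa> ! l) r)}
       \<union> {(Suc D, enc (\<kappa>, Acc, c), 0) | \<kappa> c. \<kappa> \<in> C \<and> c < (if \<sigma> \<kappa> then 2 else 1)},
     biases = {(1, enc (\<kappa>, r, c)) | \<kappa> r c. \<kappa> \<in> C \<and> c < 24 \<and> (r = Unit \<or> r = Acc)},
     inp = \<iota> \<rparr>"

lemma lin_index: "lin es v = (\<Sum>c<length es. snd (es ! c) * v (fst (es ! c)))"
  unfolding lin_def sum_list_sum_nth by (simp add: split_beta atLeast0LessThan)

locale columns = quant lam for lam :: nat +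
  fixes enc :: "'c \<times> 'd::finite reg \<times> nat \<Rightarrow> nat" and \<iota> :: "nat \<Rightarrow> 'd" and C :: "'c set" and \<sigma> :: "'c \<Rightarrow> bool"
    and D :: nat and T :: "'c \<Rightarrow> ('d reg \<Rightarrow> 'd reg list) list"
  assumes C: "finite C"
    and enc: "bij_betw enc (units C) {..<card (units C :: ('c \<times> 'd reg \<times> nat) set)}"
    and \<iota>: "bij_betw \<iota> {..<CARD('d)} UNIV"
    and T: "\<And>\<kappa> l r. \<kappa> \<in> C \<Longrightarrow> l < D \<Longrightarrow> length ((T \<kappa> ! l) r) \<le> 24"
begin

abbreviation net where "net \<equiv> network enc \<iota> C \<sigma> D T"

lemma enc_less: "\<kappa> \<in> C \<Longrightarrow> c < 24 \<Longrightarrow> enc (\<kappa>, r, c) < card (units C :: ('c \<times> 'd reg \<times> nat) set)"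
  using bij_betw_apply[OF enc, of "(\<kappa>, r, c)"] by (simp add: units_def)

lemma enc_eq:
  assumes "\<kappa> \<in> C" "c < 24" "\<kappa>' \<in> C" "c' < 24"
  shows "enc (\<kappa>, r, c) = enc (\<kappa>', r', c') \<longleftrightarrow> \<kappa> = \<kappa>' \<and> r = r' \<and> c = c'"
  using inj_onD[OF bij_betw_imp_inj_on[OF enc], of "(\<kappa>, r, c)" "(\<kappa>', r', c')"] assms
  by (auto simp: units_def)

lemma valid_net: "valid_arch net"
proof -
  have "c' < 24" if "\<kappa> \<in> C" "l < D" "c' < length ((T \<kappa> ! l) r)" for \<kappa> l r c'
    using T[OF that(1,2), of r] that(3) by simp
  moreover have "c < 24" if "c < (if \<sigma> \<kappa> then 2 else 1)" for c :: nat and \<kappa>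
    using that by (auto split: if_splits)
  ultimately show ?thesis
    using \<iota> by (auto simp: valid_arch_def network_def intro!: enc_less)
qed

lemma num_weights_net:
  "num_weights net \<le> card C * (D + 1) * (1200 * CARD('d reg))"
proof -
  let ?E0 = "{(0 :: nat, i, enc (\<kappa>, r, c)) | i \<kappa> r c. i < CARD('d) \<and> \<kappa> \<in> C \<and> c < 24 \<and> (r = Coord (\<iota> i) \<or> r = Coord' (\<iota> i))}"
  let ?E1 = "{(Suc l, enc (\<kappa>, (T \<kappa> ! l) r ! c', c'), enc (\<kappa>, r, c)) | l \<kappa> r c c'.
            l < D \<and> \<kappa> \<in> C \<and> c < 24 \<and> c' < length ((T \<kappa> ! l) r)}"
  let ?E2 = "{(Suc D, enc (\<kappa>, Acc, c), 0 :: nat) | \<kappa> c. \<kappa> \<in> C \<and> c < (if \<sigma> \<kappa> then 2 else 1)}"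
  let ?B = "{(1 :: nat, enc (\<kappa>, r, c)) | \<kappa> r c. \<kappa> \<in> C \<and> c < 24 \<and> (r = Unit \<or> r = Acc)}"
  let ?K = "CARD('d reg)"
  have le: "card A \<le> card B" if "finite B" "A \<subseteq> f ` B" for A :: "'x set" and B :: "'y set" and f
    using that by (meson card_image_le card_mono finite_imageI le_trans)
  have "?E0 \<subseteq> (\<lambda>(i, \<kappa>, c, b). (0, i, enc (\<kappa>, if b then Coord (\<iota> i) else Coord' (\<iota> i), c)))
      ` ({..<CARD('d)} \<times> C \<times> {..<24} \<times> UNIV)"
  proof
    fix e assume "e \<in> ?E0"
    then obtain i \<kappa> r c where "e = (0, i, enc (\<kappa>, r, c))" "i < CARD('d)" "\<kappa> \<in> C" "c < 24"
      "r = Coord (\<iota> i) \<or> r = Coord' (\<iota> i)" by blast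
    then show "e \<in> (\<lambda>(i, \<kappa>, c, b). (0, i, enc (\<kappa>, if b then Coord (\<iota> i) else Coord' (\<iota> i), c)))
      ` ({..<CARD('d)} \<times> C \<times> {..<24} \<times> UNIV)"
      by (intro image_eqI[of _ _ "(i, \<kappa>, c, r = Coord (\<iota> i))"]) auto
  qed
  from le[OF _ this] C have E0': "card ?E0 \<le> CARD('d) * (card C * 48)" by simp
  have dK: "CARD('d) \<le> ?K"
    using card_inj_on_le[of Coord "UNIV :: 'd set" "UNIV :: 'd reg set"] by (simp add: inj_on_def)
  have E0: "card ?E0 \<le> card C * (?K * 48)"
    using order_trans[OF E0' mult_le_mono1[OF dK]] by (simp only: mult_ac)
  have "?E1 \<subseteq> (\<lambda>(l, \<kappa>, r, c, c'). (Suc l, enc (\<kappa>, (T \<kappa> ! l) r ! c', c'), enc (\<kappa>, r, c)))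
      ` ({..<D} \<times> C \<times> UNIV \<times> {..<24} \<times> {..<24})"
  proof
    fix e assume "e \<in> ?E1"
    then obtain l \<kappa> r c c' where "e = (Suc l, enc (\<kappa>, (T \<kappa> ! l) r ! c', c'), enc (\<kappa>, r, c))"
      "l < D" "\<kappa> \<in> C" "c < 24" "c' < length ((T \<kappa> ! l) r)" by blast
    moreover then have "c' < 24" using T[of \<kappa> l r] by simp
    ultimately show "e \<in> (\<lambda>(l, \<kappa>, r, c, c'). (Suc l, enc (\<kappa>, (T \<kappa> ! l) r ! c', c'), enc (\<kappa>, r, c)))
      ` ({..<D} \<times> C \<times> UNIV \<times> {..<24} \<times> {..<24})"
      by (intro image_eqI[of _ _ "(l, \<kappa>, r, c, c')"]) auto
  qed
  from le[OF _ this] C have E1: "card ?E1 \<le> D * (card C * (?K * (24 * 24)))" by simp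
  have "?E2 \<subseteq> (\<lambda>(\<kappa>, c). (Suc D, enc (\<kappa>, Acc, c), 0)) ` (C \<times> {..<2})"
  proof
    fix e assume "e \<in> ?E2"
    then obtain \<kappa> c where "e = (Suc D, enc (\<kappa>, Acc, c), 0)" "\<kappa> \<in> C" "c < (if \<sigma> \<kappa> then 2 else 1)" by blast
    then show "e \<in> (\<lambda>(\<kappa>, c). (Suc D, enc (\<kappa>, Acc, c), 0)) ` (C \<times> {..<2})"
      by (intro image_eqI[of _ _ "(\<kappa>, c)"]) (auto split: if_splits)
  qed
  from le[OF _ this] C have E2: "card ?E2 \<le> card C * 2" by simp
  have "?B \<subseteq> (\<lambda>(\<kappa>, r, c). (1, enc (\<kappa>, r, c))) ` (C \<times> UNIV \<times> {..<24})"
    by (force simp: image_iff)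
  from le[OF _ this] C have B: "card ?B \<le> card C * (?K * 24)" by simp
  have K: "1 \<le> ?K" by (simp add: Suc_le_eq)
  have "num_weights net = card (?E0 \<union> ?E1 \<union> ?E2) + card ?B"
    by (simp add: num_weights_def network_def)
  also have "\<dots> \<le> card ?E0 + card ?E1 + card ?E2 + card ?B"
    using card_Un_le[of "?E0 \<union> ?E1" ?E2] card_Un_le[of ?E0 ?E1] by linarith
  also have "\<dots> \<le> card C * (?K * 48) + D * (card C * (?K * (24 * 24))) + card C * 2 + card C * (?K * 24)"
    using E0 E1 E2 B by linarith
  also have "\<dots> \<le> card C * (?K * 48) + D * (card C * (?K * (24 * 24))) + card C * (?K * 2) + card C * (?K * 24)"
    using K by simp
  \<comment> \<open>Per column and register there are 576 edges for each program layer and 74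
    weights for the rest; 1200 leaves room.\<close>
  also have "\<dots> \<le> card C * (D + 1) * (1200 * ?K)" by (simp add: algebra_simps)
  finally show ?thesis .
qed

context
  fixes Pr :: "'c \<Rightarrow> ('d reg \<Rightarrow> ('d reg \<times> real) list) list"
  assumes Pr: "\<And>\<kappa>. \<kappa> \<in> C \<Longrightarrow> length (Pr \<kappa>) = D" "\<And>\<kappa>. \<kappa> \<in> C \<Longrightarrow> map srcs (Pr \<kappa>) = T \<kappa>"
    and ok: "\<And>\<kappa> L. \<kappa> \<in> C \<Longrightarrow> L \<in> set (Pr \<kappa>) \<Longrightarrow> layer_ok lam L"
begin

definition dec :: "nat \<Rightarrow> 'c \<times> 'd reg \<times> nat" where
  "dec = inv_into (units C) enc"

text \<open>The copy index of the source of an edge is the position of the entry in the list of the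
  target register, so decoding both ends recovers the entry. Input and output edges carry the
  fractions that sum to 1, or -1 for a subtracted column.\<close>

definition Wt :: "nat \<times> nat \<times> nat \<Rightarrow> real" where
  "Wt = (\<lambda>(k, i, j). case dec j of (\<kappa>, r, c) \<Rightarrow> case dec i of (\<kappa>', r', c') \<Rightarrow>
     if k = 0 then (if r \<in> range Coord then 1 / lam else (real lam - 1) / lam)
     else if k = Suc D then (if \<sigma> \<kappa>' then (if c' = 0 then 1 / lam else (real lam - 1) / lam) else - 1)
     else snd ((Pr \<kappa> ! (k - 1)) r ! c'))"

definition bi :: "nat \<times> nat \<Rightarrow> real" where
  "bi = (\<lambda>(k, j). case dec j of (\<kappa>, r, c) \<Rightarrow> if r = Unit then 1 / lam else (real lam - 1) / lam)"

lemma dec_enc: "\<kappa> \<in> C \<Longrightarrow> c < 24 \<Longrightarrow> dec (enc (\<kappa>, r, c)) = (\<kappa>, r, c)"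
  unfolding dec_def by (intro inv_into_f_f bij_betw_imp_inj_on[OF enc]) (simp add: units_def)

lemma srcs_nth: "\<kappa> \<in> C \<Longrightarrow> l < D \<Longrightarrow> T \<kappa> ! l = srcs (Pr \<kappa> ! l)"
  using Pr by (metis nth_map)

lemma weights_in_net: "weights_in lam net Wt bi"
proof -
  have c24: "c' < 24" if "\<kappa> \<in> C" "l < D" "c' < length ((T \<kappa> ! l) r)" for \<kappa> l r c'
    using T[OF that(1,2), of r] that(3) by simp
  have w: "snd ((Pr \<kappa> ! l) r ! c') \<in> qweights lam"
    if "\<kappa> \<in> C" "l < D" "c' < length ((T \<kappa> ! l) r)" for \<kappa> l r c'
  proof -
    have "layer_ok lam (Pr \<kappa> ! l)" using ok that Pr(1) by (metis nth_mem)
    moreover have "(Pr \<kappa> ! l) r ! c' \<in> set ((Pr \<kappa> ! l) r)"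
      using that by (simp add: srcs_nth srcs_def)
    ultimately show ?thesis by (auto simp: layer_ok_def)
  qed
  have "c < 24" if "c < (if \<sigma> \<kappa> then 2 else 1)" for c :: nat and \<kappa>
    using that by (auto split: if_splits)
  then show ?thesis
    by (auto simp: weights_in_def network_def Wt_def bi_def dec_enc c24 w split: prod.split)
qed

text \<open>All copies of a register agree; the index is shifted by one because layer 1 holds
  \<open>init\<close>. Reading each list entry off a different copy makes repeated sources into
  distinct edges.\<close>

lemma act_net:
  assumes "l \<le> D" "\<kappa> \<in> C" "c < 24"
  shows "act net Wt bi x (Suc l) (enc (\<kappa>, r, c)) = run (take l (Pr \<kappa>)) (init x) r"
  using assms
proof (induction l arbitrary: r c)
  case 0
  have neq: "Suc 0 \<noteq> net_L net" by (simp add: network_def)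
  have bias: "(Suc 0, enc (\<kappa>, r, c)) \<in> biases net \<longleftrightarrow> r = Unit \<or> r = Acc"
    using 0 by (auto simp: network_def enc_eq)
  have edge: "(0, i, enc (\<kappa>, r, c)) \<in> edges net \<longleftrightarrow> i < CARD('d) \<and> (r = Coord (\<iota> i) \<or> r = Coord' (\<iota> i))" for i
    using 0 by (auto simp: network_def enc_eq)
  have inv: "{i. i < CARD('d) \<and> \<iota> i = a} = {inv_into {..<CARD('d)} \<iota> a}" for a
  proof -
    have "inv_into {..<CARD('d)} \<iota> a < CARD('d)" "\<iota> (inv_into {..<CARD('d)} \<iota> a) = a"
      using inv_into_into[of a \<iota> "{..<CARD('d)}"] f_inv_into_f[of a \<iota> "{..<CARD('d)}"]
        bij_betw_imp_surj_on[OF \<iota>] by auto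
    then show ?thesis using inv_into_f_f[OF bij_betw_imp_inj_on[OF \<iota>]] by (intro equalityI subsetI) auto
  qed
  have \<iota>inv: "\<iota> (inv_into {..<CARD('d)} \<iota> a) = a" for a
    using \<iota> by (metis UNIV_I bij_betw_imp_surj_on f_inv_into_f)
  have w0: "width net 0 = CARD('d)" "inp net = \<iota>" by (simp_all add: network_def)
  have sum: "(\<Sum>i\<in>{i. i < CARD('d) \<and> (r = Coord (\<iota> i) \<or> r = Coord' (\<iota> i))}. Wt (0, i, enc (\<kappa>, r, c)) * x $ \<iota> i) =
     (case r of Coord a \<Rightarrow> x $ a / lam | Coord' a \<Rightarrow> (real lam - 1) / lam * x $ a | _ \<Rightarrow> 0)"
  proof (cases r)
    case (Coord a)
    then have "{i. i < CARD('d) \<and> (r = Coord (\<iota> i) \<or> r = Coord' (\<iota> i))} = {inv_into {..<CARD('d)} \<iota> a}"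
      unfolding inv[of a, symmetric] by auto
    then show ?thesis using Coord 0 by (simp add: Wt_def dec_enc \<iota>inv split: prod.split)
  next
    case (Coord' a)
    then have "{i. i < CARD('d) \<and> (r = Coord (\<iota> i) \<or> r = Coord' (\<iota> i))} = {inv_into {..<CARD('d)} \<iota> a}"
      unfolding inv[of a, symmetric] by auto
    moreover have "Coord' a \<notin> range Coord" by auto
    ultimately show ?thesis using Coord' 0 by (simp add: Wt_def dec_enc \<iota>inv split: prod.split)
  qed simp_all
  have b: "(if r = Unit \<or> r = Acc then bi (Suc 0, enc (\<kappa>, r, c)) else 0) =
     (case r of Unit \<Rightarrow> 1 / lam | Acc \<Rightarrow> (real lam - 1) / lam | _ \<Rightarrow> 0)"
    using 0 by (cases r) (simp_all add: bi_def dec_enc)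
  show ?case
    using neq by (simp add: Let_def bias edge w0 sum b init_def cong: conj_cong) (cases r; simp)
next
  case (Suc l)
  have neq: "Suc (Suc l) \<noteq> net_L net" using Suc.prems by (simp add: network_def)
  have bias: "(Suc (Suc l), enc (\<kappa>, r, c)) \<notin> biases net"
    by (auto simp: network_def)
  let ?es = "(Pr \<kappa> ! l) r"
  have l: "l < D" using Suc.prems by simp
  have T': "(T \<kappa> ! l) r = map fst ?es" using srcs_nth[OF Suc.prems(2) l] by (simp add: srcs_def)
  have len: "length ?es \<le> 24" using T[OF Suc.prems(2) l, of r] by (simp add: T')
  have w: "width net (Suc l) = card (units C :: ('c \<times> 'd reg \<times> nat) set)"
    using l by (simp add: network_def)
  have inj: "inj_on (\<lambda>c'. enc (\<kappa>, fst (?es ! c'), c')) {..<length ?es}"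
    using len Suc.prems by (intro inj_onI) (simp add: enc_eq)
  have set: "{i. i < width net (Suc l) \<and> (Suc l, i, enc (\<kappa>, r, c)) \<in> edges net} =
      (\<lambda>c'. enc (\<kappa>, fst (?es ! c'), c')) ` {..<length ?es}"
  proof (intro equalityI subsetI)
    fix i assume "i \<in> {i. i < width net (Suc l) \<and> (Suc l, i, enc (\<kappa>, r, c)) \<in> edges net}"
    then obtain \<kappa>' r' c'' c' where *: "i = enc (\<kappa>', (T \<kappa>' ! l) r' ! c', c')" "enc (\<kappa>, r, c) = enc (\<kappa>', r', c'')"
       "\<kappa>' \<in> C" "c'' < 24" "c' < length ((T \<kappa>' ! l) r')"
      using l by (auto simp: network_def)
    then have "\<kappa>' = \<kappa>" "r' = r" using enc_eq[of \<kappa> c \<kappa>' c'' r r'] Suc.prems by auto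
    with * show "i \<in> (\<lambda>c'. enc (\<kappa>, fst (?es ! c'), c')) ` {..<length ?es}"
      by (auto simp: T')
  next
    fix i assume "i \<in> (\<lambda>c'. enc (\<kappa>, fst (?es ! c'), c')) ` {..<length ?es}"
    then obtain c' where c': "c' < length ?es" "i = enc (\<kappa>, fst (?es ! c'), c')" by auto
    have "(Suc l, enc (\<kappa>, (T \<kappa> ! l) r ! c', c'), enc (\<kappa>, r, c)) \<in> edges net"
    proof -
      have "c' < length ((T \<kappa> ! l) r)" using c'(1) by (simp add: T')
      then show ?thesis using l Suc.prems unfolding network_def arch.select_convs by blast
    qed
    then show "i \<in> {i. i < width net (Suc l) \<and> (Suc l, i, enc (\<kappa>, r, c)) \<in> edges net}"
      using c' len Suc.prems by (simp add: T' w enc_less)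
  qed
  have "(\<Sum>i\<in>{i. i < width net (Suc l) \<and> (Suc l, i, enc (\<kappa>, r, c)) \<in> edges net}.
      Wt (Suc l, i, enc (\<kappa>, r, c)) * act net Wt bi x (Suc l) i) = lin ?es (run (take l (Pr \<kappa>)) (init x))"
    unfolding set sum.reindex[OF inj] lin_index comp_def
  proof (rule sum.cong[OF refl])
    fix c' assume "c' \<in> {..<length ?es}"
    then have c': "c' < length ?es" "c' < 24" using len by auto
    have "Wt (Suc l, enc (\<kappa>, fst (?es ! c'), c'), enc (\<kappa>, r, c)) = snd (?es ! c')"
      using Suc.prems l c' by (simp add: Wt_def dec_enc)
    moreover have "act net Wt bi x (Suc l) (enc (\<kappa>, fst (?es ! c'), c')) = run (take l (Pr \<kappa>)) (init x) (fst (?es ! c'))"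
      using Suc.IH[OF _ Suc.prems(2) c'(2)] Suc.prems(1) by simp
    ultimately show "Wt (Suc l, enc (\<kappa>, fst (?es ! c'), c'), enc (\<kappa>, r, c)) *
        act net Wt bi x (Suc l) (enc (\<kappa>, fst (?es ! c'), c')) =
        snd (?es ! c') * run (take l (Pr \<kappa>)) (init x) (fst (?es ! c'))" by simp
  qed
  then have "act net Wt bi x (Suc (Suc l)) (enc (\<kappa>, r, c)) = max 0 (lin ?es (run (take l (Pr \<kappa>)) (init x)))"
    using neq bias by (simp only: act.simps(2) Let_def if_False add_0_right)
  also have "\<dots> = run (take (Suc l) (Pr \<kappa>)) (init x) r"
    using l Pr(1)[OF Suc.prems(2)] by (simp add: take_Suc_conv_app_nth step_def)
  finally show ?case .
qed

lemma net_out_net: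
  "net_out net Wt bi x = (\<Sum>\<kappa>\<in>C. (if \<sigma> \<kappa> then 1 else - 1) * run (Pr \<kappa>) (init x) Acc)"
proof -
  let ?I = "SIGMA \<kappa>:C. {..<(if \<sigma> \<kappa> then 2 else 1 :: nat)}"
  let ?f = "\<lambda>(\<kappa>, c). enc (\<kappa>, Acc, c)"
  have c24: "c < 24" if "c < (if \<sigma> \<kappa> then 2 else 1)" for c :: nat and \<kappa>
    using that by (auto split: if_splits)
  have inj: "inj_on ?f ?I"
    by (intro inj_onI) (auto simp: enc_eq c24)
  have L: "net_L net = Suc (Suc D)" by (simp add: network_def)
  have w: "width net (Suc D) = card (units C :: ('c \<times> 'd reg \<times> nat) set)"
    by (simp add: network_def)
  have bias: "(Suc (Suc D), 0) \<notin> biases net"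
    by (auto simp: network_def)
  have set: "{i. i < width net (Suc D) \<and> (Suc D, i, 0) \<in> edges net} = ?f ` ?I"
  proof (intro equalityI subsetI)
    fix i assume "i \<in> {i. i < width net (Suc D) \<and> (Suc D, i, 0) \<in> edges net}"
    then obtain \<kappa> c where "i = enc (\<kappa>, Acc, c)" "\<kappa> \<in> C" "c < (if \<sigma> \<kappa> then 2 else 1)"
      by (auto simp: network_def)
    then show "i \<in> ?f ` ?I" by (intro image_eqI[of _ _ "(\<kappa>, c)"]) auto
  next
    fix i assume "i \<in> ?f ` ?I"
    then obtain \<kappa> c where i: "i = enc (\<kappa>, Acc, c)" "\<kappa> \<in> C" "c < (if \<sigma> \<kappa> then 2 else 1)" by auto
    then have "(Suc D, i, 0) \<in> edges net" by (simp only: network_def arch.select_convs) blast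
    then show "i \<in> {i. i < width net (Suc D) \<and> (Suc D, i, 0) \<in> edges net}"
      using i c24 by (simp add: w enc_less)
  qed
  have act: "act net Wt bi x (Suc D) (enc (\<kappa>, Acc, c)) = run (Pr \<kappa>) (init x) Acc" if "\<kappa> \<in> C" "c < 24" for \<kappa> c
    using act_net[OF order_refl that, of x Acc] Pr(1)[OF that(1)] by simp
  have one: "1 / real lam + (real lam - 1) / real lam = 1" using lam by (simp add: field_simps)
  have "net_out net Wt bi x = (\<Sum>i\<in>?f ` ?I. Wt (Suc D, i, 0) * act net Wt bi x (Suc D) i)"
    using bias by (simp only: net_out_def L act.simps(2)[of _ _ _ _ "Suc D"] Let_def set if_False if_True add_0_right simp_thms)
  also have "\<dots> = (\<Sum>(\<kappa>, c)\<in>?I. (if \<sigma> \<kappa> then (if c = 0 then 1 / lam else (real lam - 1) / lam) else - 1)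
      * run (Pr \<kappa>) (init x) Acc)"
    unfolding sum.reindex[OF inj] comp_def
  proof (rule sum.cong[OF refl])
    fix e assume "e \<in> ?I"
    then obtain \<kappa> c where e: "e = (\<kappa>, c)" and "\<kappa> \<in> C" "c < 24" using c24 by auto
    show "Wt (Suc D, ?f e, 0) * act net Wt bi x (Suc D) (?f e) =
        (case e of (\<kappa>, c) \<Rightarrow> (if \<sigma> \<kappa> then (if c = 0 then 1 / lam else (real lam - 1) / lam) else - 1)
          * run (Pr \<kappa>) (init x) Acc)"
    proof -
      have "Wt (Suc D, enc (\<kappa>, Acc, c), 0) = (if \<sigma> \<kappa> then (if c = 0 then 1 / lam else (real lam - 1) / lam) else - 1)"
        using \<open>\<kappa> \<in> C\<close> \<open>c < 24\<close> by (simp add: Wt_def dec_enc split: prod.split)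
      then show ?thesis by (simp only: e prod.case act[OF \<open>\<kappa> \<in> C\<close> \<open>c < 24\<close>])
    qed
  qed
  also have "\<dots> = (\<Sum>\<kappa>\<in>C. \<Sum>c<(if \<sigma> \<kappa> then 2 else 1 :: nat). (if \<sigma> \<kappa> then (if c = 0 then 1 / lam else (real lam - 1) / lam) else - 1)
      * run (Pr \<kappa>) (init x) Acc)"
    using C by (subst sum.Sigma) auto
  also have "\<dots> = (\<Sum>\<kappa>\<in>C. (if \<sigma> \<kappa> then 1 else - 1) * run (Pr \<kappa>) (init x) Acc)"
  proof (rule sum.cong[OF refl])
    fix \<kappa>
    have "1 / real lam * v + (real lam - 1) / real lam * v = v" for v
      unfolding distrib_right[symmetric] one by simp
    then show "(\<Sum>c<(if \<sigma> \<kappa> then 2 else 1 :: nat). (if \<sigma> \<kappa> then (if c = 0 then 1 / lam else (real lam - 1) / lam) else - 1)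
      * run (Pr \<kappa>) (init x) Acc) = (if \<sigma> \<kappa> then 1 else - 1) * run (Pr \<kappa>) (init x) Acc"
      by (simp add: numeral_2_eq_2)
  qed
  finally show ?thesis .
qed

end

end

text \<open>The architecture is fixed before \<open>Pr\<close> and knows only the sources
  \<open>T\<close>. Besides the \<open>D\<close> program layers, the depth counts the inputs, the
  layer of \<open>init\<close> and the output.\<close>

lemma (in quant) compile:
  fixes C :: "'c set" and T :: "'c \<Rightarrow> ('d::finite reg \<Rightarrow> 'd reg list) list"
  assumes C: "finite C" and T: "\<forall>\<kappa>\<in>C. \<forall>l<D. \<forall>r. length ((T \<kappa> ! l) r) \<le> 24"
  shows "\<exists>A :: 'd arch. valid_arch A \<and> net_depth A = D + 3 \<and>
    num_weights A \<le> card C * (D + 1) * (1200 * CARD('d reg)) \<and>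
    (\<forall>Pr. (\<forall>\<kappa>\<in>C. length (Pr \<kappa>) = D \<and> map srcs (Pr \<kappa>) = T \<kappa> \<and> (\<forall>L\<in>set (Pr \<kappa>). layer_ok lam L)) \<longrightarrow>
      (\<exists>W b. weights_in lam A W b \<and>
        (\<forall>x. net_out A W b x = (\<Sum>\<kappa>\<in>C. (if \<sigma> \<kappa> then 1 else - 1) * run (Pr \<kappa>) (init x) Acc))))"
proof -
  obtain enc :: "'c \<times> 'd reg \<times> nat \<Rightarrow> nat" where "bij_betw enc (units C) {..<card (units C :: ('c \<times> 'd reg \<times> nat) set)}"
    using ex_bij_betw_finite_nat[OF finite_units[OF C]] by (auto simp: atLeast0LessThan)
  moreover obtain \<iota> :: "nat \<Rightarrow> 'd" where "bij_betw \<iota> {..<CARD('d)} UNIV"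
    using ex_bij_betw_nat_finite[of "UNIV :: 'd set"] by (auto simp: atLeast0LessThan)
  ultimately interpret columns lam enc \<iota> C \<sigma> D T
    using C T by unfold_locales blast+
  show ?thesis
  proof (intro exI[of _ net] conjI allI impI)
    fix Pr assume "\<forall>\<kappa>\<in>C. length (Pr \<kappa>) = D \<and> map srcs (Pr \<kappa>) = T \<kappa> \<and> (\<forall>L\<in>set (Pr \<kappa>). layer_ok lam L)"
    then show "\<exists>W b. weights_in lam net W b \<and>
        (\<forall>x. net_out net W b x = (\<Sum>\<kappa>\<in>C. (if \<sigma> \<kappa> then 1 else - 1) * run (Pr \<kappa>) (init x) Acc))"
      using weights_in_net[of Pr] net_out_net[of Pr] by blast
  qed (use valid_net num_weights_net in \<open>auto simp: net_depth_def network_def\<close>)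
qed

section \<open>The approximating network\<close>

definition err_const :: "nat \<Rightarrow> nat \<Rightarrow> real" where
  "err_const n d = leb_const n * (1 + leb_const n) ^ d"

text \<open>Coefficients of the interpolant are bounded by \<open>leb_const n ^ d\<close>, while a
  digit expansion reaches only numbers below 1. This many equal columns share one
  coefficient.\<close>

definition reps :: "nat \<Rightarrow> nat \<Rightarrow> nat" where
  "reps n d = nat \<lceil>leb_const n ^ d\<rceil> + 1"

definition col_count :: "nat \<Rightarrow> nat \<Rightarrow> nat" where
  "col_count n d = reps n d * 2 * (n + 1) ^ (2 * d)"

text \<open>Chosen so that \<open>4 ^ m\<close> exceeds the number of columns,
  \<open>col_count n d * 2 ^ (s * d)\<close>, times \<open>4 * (d * n) + 1\<close> from the error of
  one column, times \<open>2 ^ (s * n)\<close>. The constant factor \<open>c\<close> enters the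
  exponent through \<open>c \<le> 2 ^ c\<close>.\<close>

definition precision :: "nat \<Rightarrow> nat \<Rightarrow> nat \<Rightarrow> nat" where
  "precision n d s = s * (d + n) + col_count n d * (4 * (d * n) + 1)"

definition prog_length :: "nat \<Rightarrow> nat \<Rightarrow> nat \<Rightarrow> nat" where
  "prog_length n d s = 5 + s + d * n * (9 * precision n d s + 2) + 4 * precision n d s"

lemma abs_icoef_le: "q \<in> cells n N \<Longrightarrow> \<bar>icoef n q\<bar> \<le> leb_const n"
proof -
  assume "q \<in> cells n N"
  then obtain m k l where q: "q = (m, k, l)" "k \<le> n" "l \<le> n" by (auto simp: cells_def)
  have "\<bar>coeff (lag n k) l\<bar> \<le> (\<Sum>l\<le>n. \<bar>coeff (lag n k) l\<bar>)"
    using q by (intro member_le_sum) auto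
  also have "\<dots> \<le> (\<Sum>k\<le>n. \<Sum>l\<le>n. \<bar>coeff (lag n k) l\<bar>)"
    using q by (intro member_le_sum[of k "{..n}" "\<lambda>k. \<Sum>l\<le>n. \<bar>coeff (lag n k) l\<bar>"]) (auto simp: sum_nonneg)
  finally have "\<bar>coeff (lag n k) l\<bar> \<le> leb_const n" by (simp add: leb_const_def)
  then show ?thesis using q leb_const_ge_1[of n] by (auto simp: icoef_def)
qed

text \<open>Truncating \<open>\<theta>\<close> to \<open>S\<close> digits and replacing
  \<open>R\<close> by \<open>z\<close> both err downwards, so the two errors add without a mixed
  term. Truncation costs \<open>1 / lam ^ S\<close>, which is at most \<open>1 / 2 ^ S\<close> for
  every \<open>lam\<close>.\<close>

lemma (in quant) scaled_column_error:
  fixes S :: nat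
  assumes \<theta>: "0 \<le> \<theta>" "\<theta> < 1" and z: "z \<le> R" "R - e \<le> z" and R: "0 \<le> R" "R \<le> 1"
  defines "p \<equiv> nat \<lfloor>\<theta> * real lam ^ S\<rfloor>"
  shows "p < lam ^ S" "\<bar>real p / real lam ^ S * z - \<theta> * R\<bar> \<le> e + 1 / 2 ^ S"
proof -
  define L where "L = real lam ^ S"
  have L: "0 < L" "2 ^ S \<le> L" using lam by (auto simp: L_def intro: power_mono)
  have \<theta>L: "0 \<le> \<theta> * L" "\<theta> * L < L" using \<theta> L by auto
  have p: "real p \<le> \<theta> * L" "\<theta> * L < real p + 1"
    using \<theta>L(1) unfolding p_def L_def[symmetric] by linarith+
  then have "real p < L" using \<theta>L(2) by linarith
  then have "real p < real (lam ^ S)" by (simp add: L_def)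
  then show "p < lam ^ S" by (simp only: of_nat_less_iff)
  define q where "q = real p / L"
  have q: "0 \<le> q" "q \<le> \<theta>" "\<theta> - q \<le> 1 / L"
    using p L by (auto simp: q_def pos_divide_le_eq algebra_simps)
       (simp add: field_simps)
  have e: "0 \<le> e" using z by linarith
  have "\<bar>q * z - \<theta> * R\<bar> = q * (R - z) + (\<theta> - q) * R"
  proof -
    have "q * z \<le> q * R" "q * R \<le> \<theta> * R"
      using q z R by (auto intro: mult_left_mono mult_right_mono)
    then show ?thesis by (subst abs_of_nonpos) (auto simp: algebra_simps)
  qed
  also have "\<dots> \<le> 1 * e + (1 / L) * 1"
    using q z R \<theta> e L by (intro add_mono mult_mono) auto
  also have "\<dots> \<le> e + 1 / 2 ^ S" using L by (simp add: frac_le)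
  finally show "\<bar>real p / real lam ^ S * z - \<theta> * R\<bar> \<le> e + 1 / 2 ^ S" by (simp add: q_def L_def)
qed

text \<open>Powers are padded with factors 1 to exactly \<open>n\<close> factors per coordinate, so
  that all columns have the same length.\<close>

definition factors :: "nat \<Rightarrow> 'd list \<Rightarrow> ('d \<Rightarrow> nat \<times> nat \<times> nat) \<Rightarrow> 'd reg list" where
  "factors n xs q = concat (map (\<lambda>i. replicate (snd (snd (q i))) (Coord i) @ replicate (n - snd (snd (q i))) Unit) xs)"

lemma length_factors:
  assumes q: "\<And>i. snd (snd (q i)) \<le> n"
  shows "length (factors n xs q) = length xs * n"
proof (induction xs)
  case (Cons i xs)
  then show ?case using q[of i] by (simp add: factors_def)
qed (simp add: factors_def)

lemma set_factors: "set (factors n xs q) \<subseteq> insert Unit (range Coord)"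
  by (auto simp: factors_def)

lemma (in quant) prod_factors:
  "(\<Prod>F\<leftarrow>factors n xs q. rval t F) = (\<Prod>i\<leftarrow>xs. t i ^ snd (snd (q i)))"
  by (induction xs) (simp_all add: factors_def prod_list_replicate)

text \<open>Of the factor 2 in the bound, one half is the interpolation error and the other the
  arithmetic errors of all columns together.\<close>

lemma (in quant) network_exists:
  assumes n: "n \<ge> 1"
  defines "d \<equiv> CARD('d::finite)"
  obtains A :: "'d::finite arch" where "valid_arch A" "net_depth A = prog_length n d s + 3"
    "num_weights A \<le> col_count n d * 2 ^ (s * d) * (prog_length n d s + 1) * (1200 * CARD('d::finite reg))"
    "\<And>f :: real^'d::finite \<Rightarrow> real. f \<in> sobolev_class n \<Longrightarrow> \<exists>W b. weights_in lam A W b \<and>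
       (\<forall>x\<in>unit_cube. \<bar>net_out A W b x - f x\<bar> \<le> 2 * err_const n d * (1 / 2 ^ s) ^ n)"
proof -
  define N where "N = (2::nat) ^ s"
  define m where "m = precision n d s"
  define M where "M = reps n d"
  have N: "N \<ge> 1" by (simp add: N_def)
  have M: "leb_const n ^ d < real M" "0 < M"
    unfolding M_def reps_def using leb_const_ge_1[of n] by (simp_all add: of_nat_nat) linarith
  define Qs where "Qs = PiE (UNIV :: 'd set) (\<lambda>_. cells n N)"
  have fc: "finite (cells n N)" by (simp add: cells_def)
  have Qs: "finite Qs" unfolding Qs_def using fc by (intro finite_PiE) auto
  have Qin: "q i \<in> cells n N" if "q \<in> Qs" for q i using that by (auto simp: Qs_def)
  define C where "C = Qs \<times> {..<M} \<times> (UNIV :: bool set)"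
  have C: "finite C" using Qs by (simp add: C_def)
  have cardC: "card C = col_count n d * 2 ^ (s * d)"
  proof -
    have "card Qs = (N * ((n + 1) * (n + 1))) ^ d"
      by (simp add: Qs_def card_PiE cells_def d_def)
    then have "card C = (N * ((n + 1) * (n + 1))) ^ d * (M * 2)"
      unfolding C_def card_cartesian_product by simp
    also have "\<dots> = col_count n d * 2 ^ (s * d)"
      unfolding col_count_def M_def N_def power_mult power2_eq_square power_mult_distrib
      by (simp only: mult_ac)
    finally show ?thesis .
  qed
  obtain xs :: "'d list" where xs: "set xs = UNIV" "distinct xs"
    using finite_distinct_list[of "UNIV :: 'd set"] by auto
  have len_xs: "length xs = d" using distinct_card[OF xs(2)] xs(1) by (simp add: d_def)
  \<comment> \<open>Truncating a coefficient then costs at most \<open>1 / 4 ^ m\<close>, in line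
    with the accuracy of one product.\<close>
  define S where "S = 2 * m"
  define prg where "prg p \<kappa> = col_prog s m (\<lambda>i. fst (fst \<kappa> i)) (factors n xs (fst \<kappa>)) S p"
    for p :: nat and \<kappa> :: "('d \<Rightarrow> nat \<times> nat \<times> nat) \<times> nat \<times> bool"
  have len: "length (prg p \<kappa>) = prog_length n d s" if "\<kappa> \<in> C" for p \<kappa>
  proof -
    have "fst \<kappa> \<in> Qs" using that by (auto simp: C_def)
    then have "snd (snd (fst \<kappa> i)) \<le> n" for i using Qin[of "fst \<kappa>" i] by (auto simp: cells_def)
    then have "length (factors n xs (fst \<kappa>)) = d * n" using length_factors[of "fst \<kappa>" n] by (simp add: len_xs)
    then show ?thesis by (simp add: prg_def length_col S_def prog_length_def m_def)
  qed
  have ok: "layer_ok lam L" if "L \<in> set (prg p \<kappa>)" for L p \<kappa>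
    using that unfolding prg_def by (rule layer_ok_col)
  \<comment> \<open>The constant 0 is an arbitrary representative; every \<open>p\<close> has the
    same sources.\<close>
  define T where "T \<kappa> = map srcs (prg 0 \<kappa>)" for \<kappa>
  have srcs: "map srcs (prg p \<kappa>) = T \<kappa>" for p \<kappa>
    unfolding T_def prg_def by (rule srcs_col)
  have T: "length ((T \<kappa> ! l) r) \<le> 24" if "\<kappa> \<in> C" "l < prog_length n d s" for \<kappa> l r
  proof -
    have "layer_ok lam (prg 0 \<kappa> ! l)" using that len[OF that(1), of 0] by (intro ok[of _ 0 \<kappa>]) simp
    then show ?thesis using that len[OF that(1), of 0] by (simp add: T_def srcs_def layer_ok_def)
  qed
  obtain A :: "'d arch" where A: "valid_arch A" "net_depth A = prog_length n d s + 3"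
    "num_weights A \<le> card C * (prog_length n d s + 1) * (1200 * CARD('d reg))"
    "\<forall>Pr. (\<forall>\<kappa>\<in>C. length (Pr \<kappa>) = prog_length n d s \<and> map srcs (Pr \<kappa>) = T \<kappa> \<and>
        (\<forall>L\<in>set (Pr \<kappa>). layer_ok lam L)) \<longrightarrow>
      (\<exists>W b. weights_in lam A W b \<and>
        (\<forall>x. net_out A W b x = (\<Sum>\<kappa>\<in>C. (if snd (snd \<kappa>) then 1 else - 1) * run (Pr \<kappa>) (init x) Acc)))"
    using compile[OF C, of "prog_length n d s" T "\<lambda>\<kappa>. snd (snd \<kappa>)"] T by blast
  show ?thesis
  proof (rule that[OF A(1,2)])
    show "num_weights A \<le> col_count n d * 2 ^ (s * d) * (prog_length n d s + 1) * (1200 * CARD('d reg))"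
      using A(3) by (simp add: cardC)
  next
    fix f :: "real^'d \<Rightarrow> real" assume f: "f \<in> sobolev_class n"
    define a where "a q = (\<Prod>i\<in>UNIV. icoef n (q i)) * f (\<chi> j. inode n N (q j))" for q
    define R where "R x q = (\<Prod>i\<in>UNIV. ibasis N (q i) (x $ i))" for x :: "real^'d" and q
    have a_bound: "\<bar>a q\<bar> < M" if q: "q \<in> Qs" for q
    proof -
      have "(\<chi> j. inode n N (q j)) \<in> unit_cube"
        using inode_bounds[OF Qin[OF q]] by (simp add: mem_unit_cube)
      then have "\<bar>f (\<chi> j. inode n N (q j))\<bar> \<le> 1" by (rule sobolev_class_bounded[OF f])
      moreover have "\<bar>\<Prod>i\<in>UNIV. icoef n (q i)\<bar> \<le> (\<Prod>i\<in>(UNIV :: 'd set). leb_const n)"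
        unfolding abs_prod by (intro prod_mono) (auto intro: abs_icoef_le[OF Qin[OF q]])
      ultimately have "\<bar>a q\<bar> \<le> leb_const n ^ d * 1"
        unfolding a_def abs_mult d_def using leb_const_ge_1[of n] by (intro mult_mono) auto
      then show ?thesis using M(1) by simp
    qed
    \<comment> \<open>The added column gets the positive part of the coefficient and the subtracted
      one the negative part, since the sign depends on \<open>f\<close>. Each of the
      \<open>M\<close> repetitions carries an equal share.\<close>
    define \<theta> where "\<theta> \<kappa> = max 0 (if snd (snd \<kappa>) then a (fst \<kappa>) else - a (fst \<kappa>)) / M"
      for \<kappa> :: "('d \<Rightarrow> nat \<times> nat \<times> nat) \<times> nat \<times> bool"
    have \<theta>: "0 \<le> \<theta> \<kappa>" "\<theta> \<kappa> < 1" if "\<kappa> \<in> C" for \<kappa>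
      using a_bound[of "fst \<kappa>"] that M(2) by (auto simp: \<theta>_def C_def)
    define Pr where "Pr \<kappa> = prg (nat \<lfloor>\<theta> \<kappa> * real lam ^ S\<rfloor>) \<kappa>" for \<kappa>
    have "\<forall>\<kappa>\<in>C. length (Pr \<kappa>) = prog_length n d s \<and> map srcs (Pr \<kappa>) = T \<kappa> \<and> (\<forall>L\<in>set (Pr \<kappa>). layer_ok lam L)"
      using len srcs ok unfolding Pr_def by blast
    with A(4) obtain W b where W: "weights_in lam A W b"
      "\<forall>x. net_out A W b x = (\<Sum>\<kappa>\<in>C. (if snd (snd \<kappa>) then 1 else - 1) * run (Pr \<kappa>) (init x) Acc)"
      by blast
    have "\<bar>net_out A W b x - f x\<bar> \<le> 2 * err_const n d * (1 / 2 ^ s) ^ n" if x: "x \<in> unit_cube" for x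
    proof -
      define e where "e = (real (4 * (d * n)) + 1) / 4 ^ m"
      have R: "0 \<le> R x q" "R x q \<le> 1" for q
      proof -
        have "0 \<le> ibasis N r y \<and> ibasis N r y \<le> 1" for r y
          by (cases r) (auto simp: ibasis_def clip_bounds power_le_one)
        then show "0 \<le> R x q" "R x q \<le> 1"
          unfolding R_def by (blast intro: prod_nonneg prod_le_1)+
      qed
      have col: "\<bar>run (Pr \<kappa>) (init x) Acc - \<theta> \<kappa> * R x (fst \<kappa>)\<bar> \<le> e" if \<kappa>: "\<kappa> \<in> C" for \<kappa>
      proof -
        let ?q = "fst \<kappa>" and ?Fs = "factors n xs (fst \<kappa>)"
        have q: "?q \<in> Qs" using \<kappa> by (auto simp: C_def)
        have b: "fst (?q i) < 2 ^ s" for i using Qin[OF q, of i] by (auto simp: cells_def N_def)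
        have x0: "0 \<le> x $ i" for i using x by (simp add: mem_unit_cube)
        let ?p = "nat \<lfloor>\<theta> \<kappa> * real lam ^ S\<rfloor>"
        have p: "?p < lam ^ S"
          using scaled_column_error(1)[OF \<theta>[OF \<kappa>] order_refl, of 0 0 S] by simp
        have prodR: "(\<Prod>F\<leftarrow>?Fs. rval (\<lambda>i. min 1 (max 0 (2 ^ s * x $ i - real (fst (?q i))))) F) = R x ?q"
          unfolding prod_factors R_def
          by (simp add: prod.distinct_set_conv_list[OF xs(2), symmetric] xs(1) ibasis_def clip_def N_def split_beta)
        have "snd (snd (?q i)) \<le> n" for i using Qin[OF q, of i] by (auto simp: cells_def)
        then have lenF: "length ?Fs = d * n" using length_factors[of ?q n] by (simp add: len_xs)
        obtain z where z: "run (prg ?p \<kappa>) (init x) Acc = real ?p / real lam ^ S * z"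
          "z \<le> R x ?q" "R x ?q - real (d * n) * (4 / 4 ^ m) \<le> z"
          unfolding prg_def using run_col[of x "\<lambda>i. fst (?q i)" s ?p S ?Fs m, OF x0 b p set_factors]
          unfolding prodR lenF by metis
        have "\<bar>run (Pr \<kappa>) (init x) Acc - \<theta> \<kappa> * R x ?q\<bar> \<le> real (d * n) * (4 / 4 ^ m) + 1 / 2 ^ S"
          unfolding Pr_def z(1) by (rule scaled_column_error(2)[OF \<theta>[OF \<kappa>] z(2,3) R])
        also have "\<dots> = e" by (simp add: e_def S_def power_mult add_divide_distrib)
        finally show ?thesis .
      qed
      have "tensor n N UNIV f x = (\<Sum>q\<in>Qs. a q * R x q)"
        by (simp add: tensor_def Qs_def a_def R_def prod.distrib mult_ac)
      also have "\<dots> = (\<Sum>\<kappa>\<in>C. (if snd (snd \<kappa>) then 1 else - 1) * (\<theta> \<kappa> * R x (fst \<kappa>)))"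
      proof -
        have "(\<Sum>u\<in>{..<M} \<times> UNIV. (if snd u then 1 else - 1) * (\<theta> (q, u) * R x q)) = a q * R x q" for q
        proof -
          have "(\<Sum>u\<in>{..<M} \<times> UNIV. (if snd u then 1 else - 1) * (\<theta> (q, u) * R x q)) =
              (\<Sum>r<M. max 0 (a q) / M * R x q - max 0 (- a q) / M * R x q)"
            by (simp add: sum.cartesian_product' UNIV_bool \<theta>_def)
          also have "\<dots> = (max 0 (a q) - max 0 (- a q)) * R x q"
            using M(2) by (simp add: algebra_simps)
          also have "max 0 (a q) - max 0 (- a q) = a q" by simp
          finally show ?thesis .
        qed
        then show ?thesis unfolding C_def by (simp add: sum.cartesian_product' )
      qed
      finally have ten: "tensor n N UNIV f x = (\<Sum>\<kappa>\<in>C. (if snd (snd \<kappa>) then 1 else - 1) * (\<theta> \<kappa> * R x (fst \<kappa>)))" .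
      have "\<bar>net_out A W b x - tensor n N UNIV f x\<bar> \<le> (\<Sum>\<kappa>\<in>C. e)"
        unfolding W(2)[rule_format] ten sum_subtractf[symmetric] right_diff_distrib[symmetric]
        by (intro order_trans[OF sum_abs] sum_mono) (use col in \<open>auto simp: abs_mult\<close>)
      also have "\<dots> = real (col_count n d * (4 * (d * n) + 1)) * 2 ^ (s * d) / 4 ^ m"
        by (simp add: cardC e_def algebra_simps)
      also have "\<dots> \<le> 1 / 2 ^ (s * n)"
      proof -
        define c where "c = col_count n d * (4 * (d * n) + 1)"
        have "c * 2 ^ (s * d) * 2 ^ (s * n) \<le> 2 ^ c * 2 ^ (s * d) * 2 ^ (s * n)"
          using less_exp[of c] by simp
        also have "\<dots> = 2 ^ m" by (simp add: m_def precision_def c_def power_add[symmetric] algebra_simps)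
        also have "\<dots> \<le> 4 ^ m" by (intro power_mono) auto
        finally have "real (c * 2 ^ (s * d) * 2 ^ (s * n)) \<le> real (4 ^ m)" by (simp only: of_nat_le_iff)
        then have "real c * 2 ^ (s * d) * 2 ^ (s * n) \<le> 4 ^ m" by simp
        then show ?thesis unfolding c_def[symmetric] by (simp add: pos_divide_le_eq pos_le_divide_eq)
      qed
      also have "\<dots> \<le> err_const n d * (1 / 2 ^ s) ^ n"
      proof -
        have "1 \<le> err_const n d"
          using leb_const_ge_1[of n] mult_mono[of 1 "leb_const n" 1 "(1 + leb_const n) ^ d"]
          by (simp add: err_const_def)
        then have "1 * (1 / 2 ^ s) ^ n \<le> err_const n d * (1 / 2 ^ s) ^ n" by (intro mult_right_mono) auto
        moreover have "(1 / 2 ^ s) ^ n = 1 / (2::real) ^ (s * n)"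
          unfolding power_mult power_one_over ..
        ultimately show ?thesis by simp
      qed
      finally have 1: "\<bar>net_out A W b x - tensor n N UNIV f x\<bar> \<le> err_const n d * (1 / 2 ^ s) ^ n" .
      have 2: "\<bar>tensor n N UNIV f x - f x\<bar> \<le> err_const n d * (1 / 2 ^ s) ^ n"
        using tensor_error[OF f n N x, of UNIV] by (simp add: err_const_def d_def N_def)
      show ?thesis using 1 2 by linarith
    qed
    with W(1) show "\<exists>W b. weights_in lam A W b \<and>
       (\<forall>x\<in>unit_cube. \<bar>net_out A W b x - f x\<bar> \<le> 2 * err_const n d * (1 / 2 ^ s) ^ n)" by blast
  qed
qed

section \<open>Choice of the resolution and count of the weights\<close>

lemma prog_length_le:
  obtains c :: nat where "\<And>s. prog_length n d s + 3 \<le> c * (s + 1)"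
proof -
  define r where "r = d + n + col_count n d * (4 * (d * n) + 1)"
  have prec: "precision n d s \<le> r * (s + 1)" for s
    by (simp add: precision_def r_def algebra_simps)
  have "prog_length n d s + 3 \<le> (9 + d * n * (9 * r + 2) + 4 * r) * (s + 1)" for s
  proof -
    have "prog_length n d s + 3 \<le> 5 + s + d * n * (9 * (r * (s + 1)) + 2) + 4 * (r * (s + 1)) + 3"
      unfolding prog_length_def by (intro add_mono mult_mono prec) auto
    also have "\<dots> \<le> (9 + d * n * (9 * r + 2) + 4 * r) * (s + 1)" by (simp add: algebra_simps)
    finally show ?thesis .
  qed
  then show ?thesis by (rule that)
qed

theorem theorem2:
  fixes n :: nat
  assumes "n \<ge> 1"
  shows "\<exists>C > 0. \<exists>\<epsilon>0 > 0. \<forall>(lam::nat) (\<epsilon>::real). 2 \<le> lam \<longrightarrow> 0 < \<epsilon> \<longrightarrow> \<epsilon> < 1 \<longrightarrow>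
     (\<exists>A :: ('d::finite) arch. valid_arch A \<and>
        (\<epsilon> < \<epsilon>0 \<longrightarrow>
           real (net_depth A) \<le> C * log 2 (1 / \<epsilon>) \<and>
           real (num_weights A) \<le> C * ((log 2 (1 / \<epsilon>) + (log 2 (1 / \<epsilon>))\<^sup>2 / log 2 (real lam))
                                        * (1 / \<epsilon>) powr (real CARD('d) / real n)) \<and>
           num_bits lam A \<le> C * ((log 2 (real lam) * log 2 (1 / \<epsilon>) + (log 2 (1 / \<epsilon>))\<^sup>2)
                                        * (1 / \<epsilon>) powr (real CARD('d) / real n))) \<and>
        (\<forall>f \<in> sobolev_class n. \<exists>W b. weights_in lam A W b \<and>
           (\<forall>x \<in> unit_cube. \<bar>net_out A W b x - f x\<bar> \<le> \<epsilon>)))"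
proof -
  define d where "d = CARD('d)"
  define K where "K = 2 * err_const n d"
  have K: "2 \<le> K"
    using leb_const_ge_1[of n] mult_mono[of 1 "leb_const n" 1 "(1 + leb_const n) ^ d"]
    by (simp add: err_const_def K_def)
  obtain c2 where c2: "\<And>s. prog_length n d s + 3 \<le> c2 * (s + 1)"
    using prog_length_le[of n d] by blast
  define c3 where "c3 = 3 + log 2 K"
  have logK: "0 \<le> log 2 K" using K by simp
  then have c3: "0 < c3" by (simp add: c3_def)
  define k where "k = real (col_count n d) * real (1200 * CARD('d reg))"
  \<comment> \<open>The three groups account for the weights per cell and layer, the number of
    cells, and the number of layers.\<close>
  define c4 where "c4 = k * (2 ^ d * K powr (real d / real n)) * (real c2 * c3)"
  have k: "0 \<le> k" by (simp add: k_def)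
  have c4: "0 \<le> c4" unfolding c4_def using k c3 by (intro mult_nonneg_nonneg) auto
  define C where "C = real c2 * c3 + c4 + 1"
  have c2c3: "0 \<le> real c2 * c3" using c3 by simp
  have C: "0 < C" "real c2 * c3 \<le> C" "c4 \<le> C" using c2c3 c4 by (auto simp: C_def)
  show ?thesis
  \<comment> \<open>Below 1/2 the logarithm of \<open>1 / \<epsilon>\<close> is at least 1 and
    absorbs additive constants. As \<open>\<epsilon>\<close> tends to 1 it tends to 0, while the
    depth stays at least 3.\<close>
  proof (rule exI[of _ C], rule conjI[OF C(1)], rule exI[of _ "1 / 2"], intro conjI allI impI)
    fix lam :: nat and \<epsilon> :: real
    assume lam: "2 \<le> lam" and \<epsilon>: "0 < \<epsilon>" "\<epsilon> < 1"
    interpret quant lam by unfold_locales (rule lam)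
    define L where "L = log 2 (1 / \<epsilon>)"
    define P where "P = (1 / \<epsilon>) powr (real d / real n)"
    define u where "u = log 2 (K / \<epsilon>)"
    have u: "u = log 2 K + L" unfolding u_def L_def using K \<epsilon> by (simp add: log_divide)
    have L0: "0 \<le> L" using \<epsilon> by (simp add: L_def)
    have u0: "0 \<le> u" using u logK L0 by simp
    \<comment> \<open>The least \<open>s\<close> for which \<open>2 ^ (s * n)\<close> reaches
      \<open>K / \<epsilon>\<close>.\<close>
    define s where "s = nat \<lceil>u / real n\<rceil>"
    have s: "u / real n \<le> real s" "real s \<le> u / real n + 1"
      using u0 assms unfolding s_def by simp_all
    have powu: "2 powr u = K / \<epsilon>" unfolding u_def using K \<epsilon> by simp
    have err: "K * (1 / 2 ^ s) ^ n \<le> \<epsilon>"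
    proof -
      have "u \<le> real (s * n)" using s(1) assms by (simp add: pos_divide_le_eq)
      then have "K / \<epsilon> \<le> 2 powr real (s * n)" using powu by (metis powr_mono one_le_numeral)
      then have "K / \<epsilon> \<le> 2 ^ (s * n)" by (simp only: powr_realpow zero_less_numeral)
      then have "K \<le> \<epsilon> * 2 ^ (s * n)" using \<epsilon> by (simp add: pos_divide_le_eq mult.commute)
      then show ?thesis by (simp add: power_one_over power_mult pos_divide_le_eq)
    qed
    \<comment> \<open>Rounding \<open>s\<close> up costs at most a factor \<open>2 ^ d\<close>; the
      rest is \<open>(K / \<epsilon>)\<close> to the power \<open>d / n\<close>.\<close>
    have pow: "2 ^ (s * d) \<le> 2 ^ d * K powr (real d / real n) * P"
    proof -
      have "(2::real) ^ (s * d) = 2 powr (real s * real d)"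
        using powr_realpow[of 2 "s * d"] by simp
      also have "\<dots> \<le> 2 powr ((u / real n + 1) * real d)"
        using s(2) by (intro powr_mono mult_right_mono) auto
      also have "(u / real n + 1) * real d = real d + u * (real d / real n)"
        by (simp add: algebra_simps)
      also have "2 powr \<dots> = 2 ^ d * (K / \<epsilon>) powr (real d / real n)"
        by (simp add: powr_add powr_realpow powu[symmetric] powr_powr)
      also have "(K / \<epsilon>) powr (real d / real n) = K powr (real d / real n) * P"
        using K \<epsilon> powr_mult[of K "1 / \<epsilon>" "real d / real n"] by (simp add: P_def)
      finally show ?thesis by simp
    qed
    obtain A :: "'d arch" where A: "valid_arch A" "net_depth A = prog_length n d s + 3"
      "num_weights A \<le> col_count n d * 2 ^ (s * d) * (prog_length n d s + 1) * (1200 * CARD('d reg))"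
      and approx: "\<And>f :: real^'d \<Rightarrow> real. f \<in> sobolev_class n \<Longrightarrow> \<exists>W b. weights_in lam A W b \<and>
       (\<forall>x\<in>unit_cube. \<bar>net_out A W b x - f x\<bar> \<le> K * (1 / 2 ^ s) ^ n)"
      using network_exists[OF assms, of s, where 'd = 'd] unfolding d_def[symmetric] K_def by blast
    show "\<exists>A :: 'd arch. valid_arch A \<and>
        (\<epsilon> < 1 / 2 \<longrightarrow>
           real (net_depth A) \<le> C * log 2 (1 / \<epsilon>) \<and>
           real (num_weights A) \<le> C * ((log 2 (1 / \<epsilon>) + (log 2 (1 / \<epsilon>))\<^sup>2 / log 2 (real lam))
                                        * (1 / \<epsilon>) powr (real CARD('d) / real n)) \<and>
           num_bits lam A \<le> C * ((log 2 (real lam) * log 2 (1 / \<epsilon>) + (log 2 (1 / \<epsilon>))\<^sup>2)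
                                        * (1 / \<epsilon>) powr (real CARD('d) / real n))) \<and>
        (\<forall>f \<in> sobolev_class n. \<exists>W b. weights_in lam A W b \<and>
           (\<forall>x \<in> unit_cube. \<bar>net_out A W b x - f x\<bar> \<le> \<epsilon>))"
      unfolding L_def[symmetric] d_def[symmetric] P_def[symmetric]
    proof (intro exI[of _ A] conjI impI ballI A(1))
      assume \<epsilon>2: "\<epsilon> < 1 / 2"
      have "2 \<le> 1 / \<epsilon>" using \<epsilon> \<epsilon>2 by (simp add: pos_le_divide_eq)
      then have L: "1 \<le> L" unfolding L_def using \<epsilon> by (simp add: le_log_iff)
      have loglam: "0 < log 2 (real lam)" using lam by simp
      have P: "0 \<le> P" by (simp add: P_def)
      have "u / real n \<le> u" using u0 assms by (simp add: divide_le_eq mult_left_le mult_le_cancel_left1)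
      then have "real s + 1 \<le> log 2 K + L + 2" using s(2) u by linarith
      also have "\<dots> \<le> c3 * L"
        using L logK mult_left_mono[OF L logK] by (simp add: c3_def algebra_simps)
      finally have s1: "real s + 1 \<le> c3 * L" .
      have len: "real (prog_length n d s + 3) \<le> real c2 * c3 * L"
      proof -
        have "real (prog_length n d s + 3) \<le> real (c2 * (s + 1))" using c2 by (simp only: of_nat_le_iff)
        also have "\<dots> = real c2 * (real s + 1)" by (simp add: algebra_simps)
        also have "\<dots> \<le> real c2 * (c3 * L)" using s1 by (intro mult_left_mono) auto
        finally show ?thesis by simp
      qed
      show "real (net_depth A) \<le> C * L"
        unfolding A(2) using len mult_right_mono[OF C(2) L0] by linarith
      have "real (num_weights A) \<le> real (col_count n d * 2 ^ (s * d) * (prog_length n d s + 1) * (1200 * CARD('d reg)))"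
        using A(3) by (simp only: of_nat_le_iff)
      also have "\<dots> = k * 2 ^ (s * d) * real (prog_length n d s + 1)"
        by (simp add: k_def algebra_simps)
      also have "\<dots> \<le> k * (2 ^ d * K powr (real d / real n) * P) * (real c2 * c3 * L)"
        using pow len k by (intro mult_mono mult_left_mono) (auto simp: P)
      also have "\<dots> = c4 * (L * P)" by (simp add: c4_def mult_ac)
      also have "\<dots> \<le> C * (L * P)" using C(3) L P by (intro mult_right_mono) auto
      finally have num: "real (num_weights A) \<le> C * (L * P)" .
      \<comment> \<open>Columns of constant width and length of order \<open>L\<close>, in a number
        of order \<open>P\<close>, give \<open>L * P\<close>; adding a nonnegative summand brings
        this into the stated form.\<close>
      also have "\<dots> \<le> C * ((L + L\<^sup>2 / log 2 (real lam)) * P)"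
        using C(1) loglam P by (intro mult_left_mono mult_right_mono) auto
      finally show "real (num_weights A) \<le> C * ((L + L\<^sup>2 / log 2 (real lam)) * P)" .
      have "num_bits lam A \<le> C * (L * P) * log 2 (real lam)"
        unfolding num_bits_def using num loglam by (intro mult_right_mono) auto
      also have "\<dots> = C * ((log 2 (real lam) * L) * P)" by simp
      also have "\<dots> \<le> C * ((log 2 (real lam) * L + L\<^sup>2) * P)"
        using C(1) P by (intro mult_left_mono mult_right_mono) auto
      finally show "num_bits lam A \<le> C * ((log 2 (real lam) * L + L\<^sup>2) * P)" .
    next
      fix f :: "real^'d \<Rightarrow> real" assume "f \<in> sobolev_class n"
      from approx[OF this] obtain W b where W: "weights_in lam A W b"
        "\<forall>x\<in>unit_cube. \<bar>net_out A W b x - f x\<bar> \<le> K * (1 / 2 ^ s) ^ n" by blast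
      then show "\<exists>W b. weights_in lam A W b \<and> (\<forall>x\<in>unit_cube. \<bar>net_out A W b x - f x\<bar> \<le> \<epsilon>)"
        using err by (intro exI[of _ W] exI[of _ b]) (auto intro: order_trans)
    qed
  qed simp
qed

end
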